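(* If $Y$ is a proper, cocompact and geodesically complete CAT(0) space whose boundary $\partial Y$ is homeomorphic to a Cantor set, then $Y$ is quasi-isometric to a bounded valence bushy tree.
   Context: $Y$ is cocompact if there is a compact subset $K\subset Y$ with $\mathrm{Isom}(Y)\cdot K=Y$. Geodesically complete means every geodesic segment extends to a geodesic line. A bounded valence bushy tree is a simplicial tree with bounded vertex degrees and no terminal vertex (vertex of degree 1). *)

theory Defs
  imports "HOL-Analysis.Analysis"
begin

definition proper_space :: "'a::metric_space itself \<Rightarrow> bool" where
  "proper_space _ \<longleftrightarrow> (\<forall>(x::'a) r. compact (cball x r))"

definition geodesic_segment :: "(real \<Rightarrow> 'a::metric_space) \<Rightarrow> 'a \<Rightarrow> 'a \<Rightarrow> bool" where
  "geodesic_segment c x y \<longleftrightarrow> c 0 = x \<and> c (dist x y) = y \<and>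
     (\<forall>s\<in>{0..dist x y}. \<forall>t\<in>{0..dist x y}. dist (c s) (c t) = \<bar>s - t\<bar>)"

definition geodesic_line :: "(real \<Rightarrow> 'a::metric_space) \<Rightarrow> bool" where
  "geodesic_line l \<longleftrightarrow> (\<forall>s t. dist (l s) (l t) = \<bar>s - t\<bar>)"

definition geodesic_ray :: "(real \<Rightarrow> 'a::metric_space) \<Rightarrow> bool" where
  "geodesic_ray c \<longleftrightarrow> (\<forall>s\<ge>0. \<forall>t\<ge>0. dist (c s) (c t) = \<bar>s - t\<bar>)"

definition geodesic_metric_space :: "'a::metric_space itself \<Rightarrow> bool" where
  "geodesic_metric_space _ \<longleftrightarrow> (\<forall>x y::'a. \<exists>c. geodesic_segment c x y)"

definition geodesically_complete :: "'a::metric_space itself \<Rightarrow> bool" where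
  "geodesically_complete _ \<longleftrightarrow>
     (\<forall>(x::'a) y c. x \<noteq> y \<and> geodesic_segment c x y \<longrightarrow>
        (\<exists>l. geodesic_line l \<and> (\<forall>s\<in>{0..dist x y}. l s = c s)))"

text \<open>Points of a geodesic side [a,b] (parametrised by c) paired with the corresponding points
  of the side [A,B] of a Euclidean comparison triangle (in the plane, modelled by complex).\<close>
definition comparison_pairs ::
  "(real \<Rightarrow> 'a::metric_space) \<Rightarrow> 'a \<Rightarrow> 'a \<Rightarrow> complex \<Rightarrow> complex \<Rightarrow> ('a \<times> complex) set" where
  "comparison_pairs c a b A B =
     {(c s, (1 - s / dist a b) *\<^sub>R A + (s / dist a b) *\<^sub>R B) | s. s \<in> {0..dist a b}}"

definition CAT0 :: "'a::metric_space itself \<Rightarrow> bool" where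
  "CAT0 T \<longleftrightarrow> geodesic_metric_space T \<and>
     (\<forall>(p::'a) q r c1 c2 c3 P Q R.
        geodesic_segment c1 p q \<and> geodesic_segment c2 q r \<and> geodesic_segment c3 r p \<and>
        dist P Q = dist p q \<and> dist Q R = dist q r \<and> dist R P = dist r p \<longrightarrow>
        (\<forall>(x, X) \<in> comparison_pairs c1 p q P Q \<union> comparison_pairs c2 q r Q R \<union> comparison_pairs c3 r p R P.
         \<forall>(y, Y) \<in> comparison_pairs c1 p q P Q \<union> comparison_pairs c2 q r Q R \<union> comparison_pairs c3 r p R P.
           dist x y \<le> dist X Y))"

definition isometry :: "('a::metric_space \<Rightarrow> 'a) \<Rightarrow> bool" where
  "isometry g \<longleftrightarrow> bij g \<and> (\<forall>x y. dist (g x) (g y) = dist x y)"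

definition cocompact :: "'a::metric_space itself \<Rightarrow> bool" where
  "cocompact _ \<longleftrightarrow> (\<exists>K::'a set. compact K \<and> (\<forall>y. \<exists>g k. isometry g \<and> k \<in> K \<and> g k = y))"

text \<open>Geodesic rays issuing from the base point x0 (normalised to equal x0 on negative times);
  for a complete CAT(0) space these represent the points of the visual boundary bijectively.\<close>
definition rays_from :: "'a::metric_space \<Rightarrow> (real \<Rightarrow> 'a) set" where
  "rays_from x0 = {c. geodesic_ray c \<and> c 0 = x0 \<and> (\<forall>t<0. c t = x0)}"

text \<open>Cone topology on the boundary (Bridson--Haefliger II.8.6), basic neighbourhoods
  U(c,r,eps) = {c'. dist (c r) (c' r) < eps}.\<close>
definition cone_topology :: "'a::metric_space \<Rightarrow> (real \<Rightarrow> 'a) topology" where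
  "cone_topology x0 = topology_generated_by
     {{c' \<in> rays_from x0. dist (c r) (c' r) < e} | c r e. c \<in> rays_from x0 \<and> r > 0 \<and> e > 0}"

definition cantor_set :: "real set" where
  "cantor_set = {x. \<exists>d::nat \<Rightarrow> nat. (\<forall>n. d n \<in> {0, 2}) \<and> (\<lambda>n. real (d n) / 3 ^ Suc n) sums x}"

definition is_walk :: "('v \<Rightarrow> 'v \<Rightarrow> bool) \<Rightarrow> 'v list \<Rightarrow> bool" where
  "is_walk E xs \<longleftrightarrow> xs \<noteq> [] \<and> (\<forall>i. Suc i < length xs \<longrightarrow> E (xs ! i) (xs ! Suc i))"

definition graph_dist :: "('v \<Rightarrow> 'v \<Rightarrow> bool) \<Rightarrow> 'v \<Rightarrow> 'v \<Rightarrow> nat" where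
  "graph_dist E u v = (LEAST n. \<exists>xs. is_walk E xs \<and> hd xs = u \<and> last xs = v \<and> length xs = Suc n)"

definition simplicial_tree :: "'v set \<Rightarrow> ('v \<Rightarrow> 'v \<Rightarrow> bool) \<Rightarrow> bool" where
  "simplicial_tree V E \<longleftrightarrow>
     V \<noteq> {} \<and>
     (\<forall>u v. E u v \<longrightarrow> u \<in> V \<and> v \<in> V \<and> E v u \<and> u \<noteq> v) \<and>
     (\<forall>u\<in>V. \<forall>v\<in>V. \<exists>xs. is_walk E xs \<and> hd xs = u \<and> last xs = v) \<and>
     \<not> (\<exists>xs. is_walk E xs \<and> distinct xs \<and> length xs \<ge> 3 \<and> E (last xs) (hd xs))"

definition degree :: "'v set \<Rightarrow> ('v \<Rightarrow> 'v \<Rightarrow> bool) \<Rightarrow> 'v \<Rightarrow> nat" where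
  "degree V E v = card {w \<in> V. E v w}"

definition bounded_valence_bushy_tree :: "'v set \<Rightarrow> ('v \<Rightarrow> 'v \<Rightarrow> bool) \<Rightarrow> bool" where
  "bounded_valence_bushy_tree V E \<longleftrightarrow> simplicial_tree V E \<and>
     (\<exists>N. \<forall>v\<in>V. finite {w \<in> V. E v w} \<and> degree V E v \<le> N) \<and>
     (\<forall>v\<in>V. degree V E v \<noteq> 1)"

definition quasi_isometry ::
  "'a set \<Rightarrow> ('a \<Rightarrow> 'a \<Rightarrow> real) \<Rightarrow> 'b set \<Rightarrow> ('b \<Rightarrow> 'b \<Rightarrow> real) \<Rightarrow> ('a \<Rightarrow> 'b) \<Rightarrow> bool" where
  "quasi_isometry X dX Z dZ f \<longleftrightarrow> f ` X \<subseteq> Z \<and>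
     (\<exists>L C. L \<ge> 1 \<and> C \<ge> 0 \<and>
        (\<forall>x\<in>X. \<forall>y\<in>X. dX x y / L - C \<le> dZ (f x) (f y) \<and> dZ (f x) (f y) \<le> L * dX x y + C) \<and>
        (\<forall>z\<in>Z. \<exists>x\<in>X. dZ z (f x) \<le> C))"

definition quasi_isometric ::
  "'a set \<Rightarrow> ('a \<Rightarrow> 'a \<Rightarrow> real) \<Rightarrow> 'b set \<Rightarrow> ('b \<Rightarrow> 'b \<Rightarrow> real) \<Rightarrow> bool" where
  "quasi_isometric X dX Z dZ \<longleftrightarrow> (\<exists>f. quasi_isometry X dX Z dZ f)"

end

theory Submission
  imports Defs
begin

text \<open>
  The boundary at \<open>x0\<close> is compact and totally disconnected, so rays that are joined by a chain of
  rays with small steps at a large time \<open>T\<close> are close to each other at a prescribed earlier time.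
  Consequently, if a geodesic from \<open>x\<close> to \<open>y\<close> passes near \<open>x0\<close>, every chain with small steps from
  \<open>x\<close> to \<open>y\<close> has to enter the ball of radius \<open>T\<close> about \<open>x0\<close>; cocompactness makes this a uniform
  bottleneck property at every point \<open>q\<close> of every geodesic. It follows that the chain components of
  the complements of the balls \<open>B(x0, n R)\<close> meet the spheres of radius \<open>n R\<close> in sets of uniformly
  bounded diameter. Ordered by inclusion, these components form the tree: geodesic completeness
  yields children for each vertex, and cocompactness bounds the valence.
\<close>

section \<open>The Cantor set\<close>

text \<open>Self-similarity of the Cantor set: dropping the leading ternary digit \<open>d 0\<close>
  turns \<open>x\<close> into \<open>y = 3 * x - d 0\<close>.\<close>

lemma cantor_set_unfold:
  assumes "x \<in> cantor_set"
  obtains y where "y \<in> cantor_set" "x = y / 3 \<or> x = (2 + y) / 3"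
proof -
  from assms obtain d :: "nat \<Rightarrow> nat" where d: "\<And>n. d n \<in> {0,2}"
    and s: "(\<lambda>n. real (d n) / 3 ^ Suc n) sums x"
    by (auto simp: cantor_set_def)
  let ?y = "3 * x - d 0"
  have "(\<lambda>n. real (d (Suc n)) / 3 ^ Suc (Suc n)) sums (x - real (d 0) / 3)"
    using s sums_Suc_iff[of "\<lambda>n. real (d n) / 3 ^ Suc n" "x - real (d 0) / 3"] by simp
  from sums_mult[OF this, of 3] have "(\<lambda>n. real (d (Suc n)) / 3 ^ Suc n) sums ?y"
    by (simp add: algebra_simps)
  then have "?y \<in> cantor_set"
    unfolding cantor_set_def using d by (intro CollectI exI[of _ "\<lambda>n. d (Suc n)"]) auto
  moreover have "x = ?y / 3 \<or> x = (2 + ?y) / 3" using d[of 0] by auto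
  ultimately show ?thesis by (rule that)
qed

lemma cantor_set_subset_unit_interval: "cantor_set \<subseteq> {0..1}"
proof
  fix x assume "x \<in> cantor_set"
  then obtain d :: "nat \<Rightarrow> nat" where d: "\<And>n. d n \<in> {0,2}"
    and s: "(\<lambda>n. real (d n) / 3 ^ Suc n) sums x"
    by (auto simp: cantor_set_def)
  have "(\<lambda>n. 2 / 3 * (1 / 3) ^ n :: real) sums (2 / 3 * (1 / (1 - 1 / 3)))"
    by (intro sums_mult geometric_sums) simp
  then have g: "(\<lambda>n. 2 / 3 ^ Suc n :: real) sums 1"
    by (simp add: power_divide)
  have le: "real (d n) / 3 ^ Suc n \<le> 2 / 3 ^ Suc n" for n
    using d[of n] by (intro divide_right_mono) auto
  have ge: "0 \<le> real (d n) / 3 ^ Suc n" for n by simp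
  show "x \<in> {0..1}"
    using sums_le[OF le s g] sums_le[OF ge sums_zero s] by simp
qed

text \<open>These numbers are midpoints of triadic intervals. Unfolding one digit gives a number of
  the same kind with a smaller power of 3, down to \<open>1 / 2\<close>, which lies in the first
  middle gap.\<close>

lemma half_integer_over_power_notin_cantor_set:
  "(real_of_int k + 1 / 2) / 3 ^ n \<notin> cantor_set"
proof (induction n arbitrary: k)
  case 0
  show ?case
  proof
    assume a: "(real_of_int k + 1 / 2) / 3 ^ 0 \<in> cantor_set"
    then have "0 \<le> real_of_int k + 1 / 2" "real_of_int k + 1 / 2 \<le> 1"
      using cantor_set_subset_unit_interval by auto
    then have "k = 0" by linarith
    with a have "1 / 2 \<in> cantor_set" by simp
    then obtain y where "y \<in> cantor_set" "1 / 2 = y / 3 \<or> 1 / 2 = (2 + y) / 3"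
      by (rule cantor_set_unfold)
    then show False using cantor_set_subset_unit_interval by (auto simp: subset_iff)
  qed
next
  case (Suc n)
  show ?case
  proof
    assume "(real_of_int k + 1 / 2) / 3 ^ Suc n \<in> cantor_set"
    then obtain y where y: "y \<in> cantor_set"
      "(real_of_int k + 1 / 2) / 3 ^ Suc n = y / 3 \<or> (real_of_int k + 1 / 2) / 3 ^ Suc n = (2 + y) / 3"
      by (rule cantor_set_unfold)
    \<comment> \<open>The digit 2 shifts the integer \<open>k\<close> by \<open>2 * 3 ^ n\<close>,
      which is why the induction keeps \<open>k\<close> arbitrary.\<close>
    then have "y = (real_of_int k + 1 / 2) / 3 ^ n \<or>
        y = (real_of_int (k - 2 * 3 ^ n) + 1 / 2) / 3 ^ n"
      by (auto simp: field_simps)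
    then show False using y(1) Suc.IH by blast
  qed
qed

text \<open>Total disconnectedness in the form used for the boundary: an interval around a point can
  be given endpoints in gaps.\<close>

lemma notin_cantor_set_between:
  fixes x y :: real
  assumes "x < y"
  obtains z where "x < z" "z < y" "z \<notin> cantor_set"
proof -
  obtain n where n: "(1 / 3) ^ n < (y - x) / 2"
    using real_arch_pow_inv[of "(y - x) / 2" "1/3"] assms by auto
  \<comment> \<open>The spacing \<open>1 / 3 ^ n\<close> is below half of \<open>y - x\<close>, and
    \<open>?z\<close> lies at most one and a half spacings to the right of \<open>x\<close>.\<close>
  let ?k = "\<lfloor>3 ^ n * x\<rfloor> + 1"
  let ?z = "(real_of_int ?k + 1 / 2) / 3 ^ n"
  have "1 < 3 ^ n * (y - x) / 2" using n by (simp add: field_simps)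
  then have "2 < 3 ^ n * y - 3 ^ n * x" by (simp add: algebra_simps)
  then have "3 ^ n * x < real_of_int ?k + 1 / 2" "real_of_int ?k + 1 / 2 < 3 ^ n * y"
    by linarith+
  then have "x < ?z" "?z < y" by (simp_all add: field_simps)
  then show ?thesis using that half_integer_over_power_notin_cantor_set by blast
qed

text \<open>The set is the image of a compact product of copies of \<open>{0,2}\<close> under the
  ternary expansion, which is continuous as a uniform limit of its partial sums.\<close>

lemma compact_cantor_set: "compact cantor_set"
proof -
  define D :: "(nat \<Rightarrow> real) set" where "D = (\<Pi>\<^sub>E n\<in>UNIV. {0,2})"
  define F :: "(nat \<Rightarrow> real) \<Rightarrow> real" where "F = (\<lambda>d. \<Sum>n. d n / 3 ^ Suc n)"
  have D: "d n \<in> {0,2}" if "d \<in> D" for d n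
    using that by (auto simp: D_def PiE_def Pi_def)
  have bound: "norm (d n / 3 ^ Suc n) \<le> 2 / 3 ^ Suc n" if "d \<in> D" for d n
    using D[OF that, of n] by auto
  have "summable (\<lambda>n. 2 / 3 * (1 / 3) ^ n :: real)"
    by (intro summable_mult summable_geometric) simp
  then have g: "summable (\<lambda>n. 2 / 3 ^ Suc n :: real)"
    by (simp add: power_divide)
  have "compact D"
  proof -
    have "compactin (product_topology (\<lambda>n::nat. euclidean) UNIV) D"
      unfolding D_def by (subst compactin_PiE) auto
    then show ?thesis by (simp add: euclidean_product_topology)
  qed
  moreover have "continuous_on D F"
  proof (rule uniform_limit_theorem)
    show "uniform_limit D (\<lambda>n d. \<Sum>i<n. d i / 3 ^ Suc i) F sequentially"
      unfolding F_def using bound g by (intro Weierstrass_m_test) auto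
    show "\<forall>\<^sub>F n in sequentially. continuous_on D (\<lambda>d. \<Sum>i<n. d i / 3 ^ Suc i)"
      by (intro always_eventually allI continuous_intros
          continuous_on_subset[OF continuous_on_product_coordinates]) auto
  qed simp
  ultimately have "compact (F ` D)" by (rule compact_continuous_image[rotated])
  moreover have "F ` D = cantor_set"
  proof (intro equalityI subsetI)
    fix x assume "x \<in> F ` D"
    then obtain d where d: "d \<in> D" "x = F d" by auto
    have "summable (\<lambda>n. d n / 3 ^ Suc n)"
      using bound[OF d(1)] by (intro summable_comparison_test'[OF g]) auto
    \<comment> \<open>The digits in \<open>D\<close> are real numbers, whereas
      \<open>cantor_set\<close> uses natural ones; the floor converts them.\<close>
    moreover have "real (nat \<lfloor>d n\<rfloor>) = d n" for n using D[OF d(1), of n] by auto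
    ultimately have "(\<lambda>n. real (nat \<lfloor>d n\<rfloor>) / 3 ^ Suc n) sums x"
      unfolding d(2) F_def by (simp add: summable_sums)
    moreover have "nat \<lfloor>d n\<rfloor> \<in> {0,2}" for n using D[OF d(1), of n] by auto
    ultimately show "x \<in> cantor_set"
      unfolding cantor_set_def by (intro CollectI exI[of _ "\<lambda>n. nat \<lfloor>d n\<rfloor>"]) simp
  next
    fix x assume "x \<in> cantor_set"
    then obtain d :: "nat \<Rightarrow> nat" where d: "\<And>n. d n \<in> {0,2}"
      and s: "(\<lambda>n. real (d n) / 3 ^ Suc n) sums x"
      by (auto simp: cantor_set_def)
    have "(\<lambda>n. real (d n)) \<in> D" using d by (auto simp: D_def PiE_def Pi_def)
    moreover have "x = F (\<lambda>n. real (d n))" using s by (simp add: F_def sums_unique)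
    ultimately show "x \<in> F ` D" by blast
  qed
  ultimately show ?thesis by simp
qed

lemma zero_in_cantor_set: "0 \<in> cantor_set"
  unfolding cantor_set_def by (auto intro!: exI[of _ "\<lambda>_. 0"])

section \<open>Rays and the cone topology\<close>

lemma CAT0_imp_geodesic: "CAT0 TYPE('a::metric_space) \<Longrightarrow> geodesic_metric_space TYPE('a)"
  by (simp add: CAT0_def)

lemma geodesic_segment_exists:
  fixes x y :: "'a::metric_space"
  assumes "geodesic_metric_space TYPE('a)"
  obtains c where "geodesic_segment c x y"
  using assms unfolding geodesic_metric_space_def by blast

text \<open>Singles out the two sides meeting in \<open>p\<close>, the case that applies to two rays
  issuing from a common point.\<close>

lemma CAT0_comparison:
  fixes p q r :: "'a::metric_space"
  assumes "CAT0 TYPE('a)" "geodesic_segment c1 p q" "geodesic_segment c2 q r" "geodesic_segment c3 r p"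
    "dist P Q = dist p q" "dist Q R = dist q r" "dist R P = dist r p"
    "(x, X) \<in> comparison_pairs c1 p q P Q" "(y, Y) \<in> comparison_pairs c3 r p R P"
  shows "dist x y \<le> dist X Y"
proof -
  let ?S = "comparison_pairs c1 p q P Q \<union> comparison_pairs c2 q r Q R \<union> comparison_pairs c3 r p R P"
  have "\<forall>(x, X)\<in>?S. \<forall>(y, Y)\<in>?S. dist x y \<le> dist X Y"
    using assms(1)[unfolded CAT0_def, THEN conjunct2, rule_format, of c1 p q c2 r c3 P Q R] assms(2-7)
    by blast
  then have "\<forall>(y, Y)\<in>?S. dist x y \<le> dist X Y" using assms(8) by blast
  then show ?thesis using assms(9) by blast
qed

lemma rays_from_dist:
  assumes "c \<in> rays_from x0" "0 \<le> s" "0 \<le> t"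
  shows "dist (c s) (c t) = \<bar>s - t\<bar>"
  using assms by (auto simp: rays_from_def geodesic_ray_def)

lemma rays_from_zero: "c \<in> rays_from x0 \<Longrightarrow> c 0 = x0"
  by (simp add: rays_from_def)

lemma rays_from_dist_base:
  assumes "c \<in> rays_from x0" "0 \<le> t"
  shows "dist x0 (c t) = t"
  using rays_from_dist[OF assms(1), of 0 t] assms rays_from_zero[OF assms(1)] by simp

text \<open>In the comparison triangle with apex \<open>P\<close>, points at the same fraction
  \<open>s / t\<close> of the two legs are \<open>s / t * d\<close> apart, which is at most
  \<open>d\<close>. Thus closeness at a late time passes to all earlier times.\<close>

lemma rays_from_dist_mono:
  fixes x0 :: "'a::metric_space"
  assumes cat: "CAT0 TYPE('a)" and c: "c \<in> rays_from x0" and c': "c' \<in> rays_from x0"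
    and st: "0 \<le> s" "s \<le> t"
  shows "dist (c s) (c' s) \<le> dist (c t) (c' t)"
proof (cases "t = 0")
  case True
  then show ?thesis using st by simp
next
  case False
  then have t: "0 < t" using st by simp
  define d where "d = dist (c t) (c' t)"
  \<comment> \<open>\<open>h\<close> is the height of the isosceles triangle with legs
    \<open>t\<close> and base \<open>d\<close>; the root is taken of a nonnegative number because
    \<open>d \<le> 2 * t\<close>.\<close>
  define h where "h = sqrt (t\<^sup>2 - (d / 2)\<^sup>2)"
  define P Q R where "P = (0::complex)" and "Q = Complex h (d / 2)" and "R = Complex h (- d / 2)"
  have dt: "dist x0 (c t) = t" "dist x0 (c' t) = t"
    using rays_from_dist_base[OF c, of t] rays_from_dist_base[OF c', of t] t by auto
  have "d \<le> 2 * t"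
    unfolding d_def using dist_triangle[of "c t" "c' t" x0] dt by (simp add: dist_commute)
  then have "(d / 2)\<^sup>2 \<le> t\<^sup>2"
    by (intro power_mono) (auto simp: d_def)
  then have "h\<^sup>2 = t\<^sup>2 - (d / 2)\<^sup>2" by (simp add: h_def)
  then have "dist P Q = t" "dist R P = t"
    using t by (simp_all add: P_def Q_def R_def dist_norm cmod_def)
  have QR: "Q - R = Complex 0 d" by (simp add: Q_def R_def complex_eq_iff)
  have "dist Q R = d"
    unfolding dist_norm QR by (simp add: cmod_def d_def)
  obtain e where e: "geodesic_segment e (c t) (c' t)"
    using geodesic_segment_exists[OF CAT0_imp_geodesic[OF cat]] by blast
  have g1: "geodesic_segment c x0 (c t)"
    using rays_from_dist[OF c] rays_from_zero[OF c] dt by (auto simp: geodesic_segment_def)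
  \<comment> \<open>The third side runs towards \<open>x0\<close>, so \<open>c'\<close> is traversed
    backwards and its point at time \<open>s\<close> has parameter \<open>t - s\<close>.\<close>
  have g3: "geodesic_segment (\<lambda>s. c' (t - s)) (c' t) x0"
    using rays_from_dist[OF c'] rays_from_zero[OF c'] dt
    by (auto simp: geodesic_segment_def dist_commute)
  have "(c s, (1 - s / t) *\<^sub>R P + (s / t) *\<^sub>R Q) \<in> comparison_pairs c x0 (c t) P Q"
    unfolding comparison_pairs_def dt using st by auto
  moreover have "(c' (t - (t - s)), (1 - (t - s) / t) *\<^sub>R R + ((t - s) / t) *\<^sub>R P)
      \<in> comparison_pairs (\<lambda>s. c' (t - s)) (c' t) x0 R P"
    unfolding comparison_pairs_def using st dt
    by (auto simp: dist_commute intro!: exI[of _ "t - s"])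
  ultimately have "dist (c s) (c' (t - (t - s))) \<le>
      dist ((1 - s / t) *\<^sub>R P + (s / t) *\<^sub>R Q) ((1 - (t - s) / t) *\<^sub>R R + ((t - s) / t) *\<^sub>R P)"
    using \<open>dist P Q = t\<close> \<open>dist R P = t\<close> \<open>dist Q R = d\<close> dt
    by (intro CAT0_comparison[OF cat g1 e g3]) (auto simp: d_def dist_commute)
  also have "\<dots> = norm ((s / t) *\<^sub>R (Q - R))"
    using t by (simp add: P_def dist_norm diff_divide_distrib scaleR_diff_right)
  also have "\<dots> = s / t * d"
    using \<open>dist Q R = d\<close> st t by (simp add: dist_norm)
  also have "\<dots> \<le> 1 * d"
    using st t by (intro mult_right_mono) (auto simp: d_def)
  finally show ?thesis by (simp add: d_def)
qed

text \<open>Extend a segment from \<open>x0\<close> to \<open>x\<close> to a line and keep its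
  nonnegative half. For \<open>x = x0\<close> there is no nondegenerate segment to extend, and any
  existing ray is taken.\<close>

lemma ray_through_point:
  fixes x0 :: "'a::metric_space"
  assumes gc: "geodesically_complete TYPE('a)" and cat: "CAT0 TYPE('a)" and ne: "rays_from x0 \<noteq> {}"
  obtains c where "c \<in> rays_from x0" "c (dist x0 x) = x"
proof (cases "x = x0")
  case True
  then show ?thesis using that ne rays_from_zero by fastforce
next
  case False
  obtain e where e: "geodesic_segment e x0 x"
    using geodesic_segment_exists[OF CAT0_imp_geodesic[OF cat]] by blast
  then obtain l where l: "geodesic_line l" "\<And>s. s \<in> {0..dist x0 x} \<Longrightarrow> l s = e s"
    using gc False unfolding geodesically_complete_def by metis
  define c where "c t = (if t < 0 then x0 else l t)" for t
  have "l 0 = x0" "l (dist x0 x) = x" using l e by (auto simp: geodesic_segment_def)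
  then have "c \<in> rays_from x0" "c (dist x0 x) = x"
    using l(1) by (auto simp: rays_from_def geodesic_ray_def geodesic_line_def c_def)
  then show ?thesis by (rule that)
qed

section \<open>The cone topology on the set of rays\<close>

lemma topspace_cone_topology: "topspace (cone_topology x0) = rays_from x0"
  unfolding cone_topology_def topology_generated_by_topspace
proof (intro equalityI subsetI)
  fix c assume "c \<in> rays_from x0"
  then show "c \<in> \<Union>{{c' \<in> rays_from x0. dist (c r) (c' r) < e} | c r e.
      c \<in> rays_from x0 \<and> r > 0 \<and> e > 0}"
    by (intro UnionI[of "{c' \<in> rays_from x0. dist (c 1) (c' 1) < 1}"] CollectI exI[of _ c]
        exI[of _ "1::real"]) auto
qed auto

lemma openin_cone_topology_basic:
  assumes "c \<in> rays_from x0" "0 < r" "0 < e"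
  shows "openin (cone_topology x0) {c' \<in> rays_from x0. dist (c r) (c' r) < e}"
  unfolding cone_topology_def
  by (rule topology_generated_by_Basis, rule CollectI, rule exI[of _ c], rule exI[of _ r],
      rule exI[of _ e]) (simp add: assms)

text \<open>For an intersection the later of the two times serves, by
  \<open>rays_from_dist_mono\<close>; a generating set centred at another ray is recentred at
  \<open>u\<close> by the triangle inequality.\<close>

lemma openin_cone_topologyD:
  fixes x0 :: "'a::metric_space"
  assumes cat: "CAT0 TYPE('a)" and "openin (cone_topology x0) U" "u \<in> U"
  shows "\<exists>r>0. \<exists>e>0. \<forall>v\<in>rays_from x0. dist (u r) (v r) < e \<longrightarrow> v \<in> U"
proof -
  have "generate_topology_on {{c' \<in> rays_from x0. dist (c r) (c' r) < e} | c r e.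
      c \<in> rays_from x0 \<and> r > 0 \<and> e > 0} U"
    using assms(2) unfolding cone_topology_def by (rule openin_topology_generated_by)
  moreover have ur: "u \<in> rays_from x0"
    using openin_subset[OF assms(2)] assms(3) topspace_cone_topology by blast
  ultimately show ?thesis using assms(3)
  proof (induction rule: generate_topology_on.induct)
    case Empty
    then show ?case by simp
  next
    case (Int A B)
    obtain r e where A: "r > 0" "e > 0"
      "\<And>v. v \<in> rays_from x0 \<Longrightarrow> dist (u r) (v r) < e \<Longrightarrow> v \<in> A"
      using Int.IH(1)[OF ur] Int.prems by blast
    obtain r' e' where B: "r' > 0" "e' > 0"
      "\<And>v. v \<in> rays_from x0 \<Longrightarrow> dist (u r') (v r') < e' \<Longrightarrow> v \<in> B"
      using Int.IH(2)[OF ur] Int.prems by blast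
    show ?case
    proof (intro exI conjI ballI impI)
      show "max r r' > 0" "min e e' > 0" using A B by auto
      fix v assume v: "v \<in> rays_from x0" "dist (u (max r r')) (v (max r r')) < min e e'"
      then show "v \<in> A \<inter> B"
        using A(3)[OF v(1)] B(3)[OF v(1)] rays_from_dist_mono[OF cat ur v(1), of r "max r r'"]
          rays_from_dist_mono[OF cat ur v(1), of r' "max r r'"] A(1) B(1) by auto
    qed
  next
    case (UN K)
    then obtain S where S: "S \<in> K" "u \<in> S" by blast
    then show ?case using UN.IH[OF S(1) ur S(2)] by blast
  next
    case (Basis S)
    then obtain c r e where S: "S = {c' \<in> rays_from x0. dist (c r) (c' r) < e}" "r > 0" "e > 0"
      by blast
    then have "dist (c r) (u r) < e" using Basis by simp
    show ?case
    proof (intro exI conjI ballI impI)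
      show "r > 0" "e - dist (c r) (u r) > 0" using S \<open>dist (c r) (u r) < e\<close> by auto
      fix v assume "v \<in> rays_from x0" "dist (u r) (v r) < e - dist (c r) (u r)"
      then show "v \<in> S"
        using dist_triangle[of "c r" "v r" "u r"] S(1) by simp
    qed
  qed
qed

text \<open>A Lebesgue number argument: finitely many basic neighbourhoods of half radius cover the
  compact set \<open>U\<close>, the other half absorbs the step from \<open>u\<close> to
  \<open>v\<close>, and monotonicity admits every later time.\<close>

lemma clopen_separated:
  fixes x0 :: "'a::metric_space"
  assumes cat: "CAT0 TYPE('a)" and U: "openin (cone_topology x0) U" "compactin (cone_topology x0) U"
  shows "\<exists>T>0. \<exists>e>0. \<forall>t\<ge>T. \<forall>u\<in>U. \<forall>v\<in>rays_from x0. dist (u t) (v t) < e \<longrightarrow> v \<in> U"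
proof -
  have Ur: "U \<subseteq> rays_from x0" using openin_subset[OF U(1)] topspace_cone_topology by metis
  have "\<exists>r e. r > 0 \<and> e > 0 \<and> (\<forall>v\<in>rays_from x0. dist (u r) (v r) < e \<longrightarrow> v \<in> U)" if "u \<in> U" for u
    using openin_cone_topologyD[OF cat U(1) that] by blast
  then obtain r e where re: "\<And>u. u \<in> U \<Longrightarrow> r u > 0" "\<And>u. u \<in> U \<Longrightarrow> e u > (0::real)"
    "\<And>u v. u \<in> U \<Longrightarrow> v \<in> rays_from x0 \<Longrightarrow> dist (u (r u)) (v (r u)) < e u \<Longrightarrow> v \<in> U"
    by metis
  define B where "B u = {v \<in> rays_from x0. dist (u (r u)) (v (r u)) < e u / 2}" for u
  have "\<exists>\<F>. finite \<F> \<and> \<F> \<subseteq> B ` U \<and> U \<subseteq> \<Union>\<F>"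
  proof (rule compactinD[OF U(2)])
    show "openin (cone_topology x0) V" if V: "V \<in> B ` U" for V
    proof -
      obtain u where u: "u \<in> U" "V = B u" using V by blast
      then show ?thesis
        unfolding u(2) B_def using Ur re(1,2) by (intro openin_cone_topology_basic) auto
    qed
    show "U \<subseteq> \<Union>(B ` U)" using Ur re by (auto simp: B_def)
  qed
  then obtain F where F: "finite F" "F \<subseteq> U" "U \<subseteq> \<Union>(B ` F)"
    by (metis finite_subset_image)
  \<comment> \<open>Inserting 1 keeps \<open>Max\<close> and \<open>Min\<close> defined and positive
    even for an empty cover.\<close>
  define T where "T = Max (insert 1 (r ` F))"
  define \<epsilon> where "\<epsilon> = Min (insert 1 ((\<lambda>u. e u / 2) ` F))"
  have T: "T \<ge> 1" "\<And>u. u \<in> F \<Longrightarrow> r u \<le> T" using F(1) by (auto simp: T_def)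
  have "\<epsilon> > 0" using F(1,2) re(2) by (auto simp: \<epsilon>_def)
  moreover have "\<epsilon> \<le> e u / 2" if "u \<in> F" for u
    unfolding \<epsilon>_def using F(1) that by (intro Min_le) auto
  ultimately have e: "\<epsilon> > 0" "\<And>u. u \<in> F \<Longrightarrow> \<epsilon> \<le> e u / 2" by auto
  show ?thesis
  proof (rule exI[of _ T], intro conjI exI[of _ \<epsilon>] allI ballI impI)
    show "T > 0" "\<epsilon> > 0" using T e by auto
    fix t u v assume tuv: "T \<le> t" "u \<in> U" "v \<in> rays_from x0" "dist (u t) (v t) < \<epsilon>"
    then obtain w where w: "w \<in> F" "u \<in> B w" using F(3) by blast
    then have wU: "w \<in> U" using F by blast
    have "dist (u (r w)) (v (r w)) \<le> dist (u t) (v t)"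
      using tuv Ur re(1)[OF wU] T(2)[OF w(1)] by (intro rays_from_dist_mono[OF cat]) auto
    then have "dist (w (r w)) (v (r w)) < e w"
      using w tuv e(2)[OF w(1)] dist_triangle[of "w (r w)" "v (r w)" "u (r w)"] by (auto simp: B_def)
    then show "v \<in> U" using re(3)[OF wU tuv(3)] by simp
  qed
qed

text \<open>An interval around \<open>h c\<close> whose endpoints \<open>a\<close> and
  \<open>b\<close> miss the Cantor set has the same preimage whether it is taken open or closed.
  This preimage is therefore clopen, hence compact.\<close>

lemma cantor_boundary_clopen_neighbourhood:
  assumes hom: "cone_topology x0 homeomorphic_space (top_of_set cantor_set)"
    and W: "openin (cone_topology x0) W" "c \<in> W"
  obtains U where "openin (cone_topology x0) U" "compactin (cone_topology x0) U" "c \<in> U" "U \<subseteq> W"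
proof -
  obtain h where h: "homeomorphic_map (cone_topology x0) (top_of_set cantor_set) h"
    using hom by (auto simp: homeomorphic_space)
  have cont: "continuous_map (cone_topology x0) euclideanreal h"
    using homeomorphic_imp_continuous_map[OF h] continuous_map_in_subtopology by blast
  have inj: "inj_on h (topspace (cone_topology x0))"
    and surj: "h ` topspace (cone_topology x0) = cantor_set"
    using homeomorphic_imp_injective_map[OF h] homeomorphic_imp_surjective_map[OF h] by auto
  have comp: "compact_space (cone_topology x0)"
    using homeomorphic_compact_space[OF hom] compact_cantor_set
    by (simp add: compact_space_subtopology)
  have Wsub: "W \<subseteq> topspace (cone_topology x0)" by (rule openin_subset[OF W(1)])
  have "openin (top_of_set cantor_set) (h ` W)"
    using homeomorphic_map_openness[OF h Wsub] W(1) by simp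
  then obtain d where d: "d > 0" "\<And>y. y \<in> cantor_set \<Longrightarrow> dist y (h c) < d \<Longrightarrow> y \<in> h ` W"
    using W(2) unfolding openin_euclidean_subtopology_iff by (metis imageI)
  obtain a where a: "h c - d < a" "a < h c" "a \<notin> cantor_set"
    using notin_cantor_set_between[of "h c - d" "h c"] d(1) by auto
  obtain b where b: "h c < b" "b < h c + d" "b \<notin> cantor_set"
    using notin_cantor_set_between[of "h c" "h c + d"] d(1) by auto
  define U where "U = {u \<in> topspace (cone_topology x0). h u \<in> {a<..<b}}"
  have "h u \<in> cantor_set" if "u \<in> topspace (cone_topology x0)" for u
    using that surj by blast
  then have U': "U = {u \<in> topspace (cone_topology x0). h u \<in> {a..b}}"
    using a(3) b(3) unfolding U_def by (force simp: less_le)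
  have "openin (cone_topology x0) U"
    unfolding U_def by (rule openin_continuous_map_preimage[OF cont]) simp
  moreover have "closedin (cone_topology x0) U"
    unfolding U' by (rule closedin_continuous_map_preimage[OF cont]) simp
  then have "compactin (cone_topology x0) U"
    by (rule closedin_compact_space[OF comp])
  moreover have "c \<in> U" using W Wsub a b by (auto simp: U_def)
  moreover have "U \<subseteq> W"
  proof
    fix u assume u: "u \<in> U"
    then have "h u \<in> cantor_set" using surj by (auto simp: U_def)
    moreover have "dist (h u) (h c) < d" using u a b by (auto simp: U_def dist_real_def)
    ultimately have "h u \<in> h ` W" by (rule d(2))
    then show "u \<in> W" using inj u Wsub by (auto simp: U_def inj_on_def)
  qed
  ultimately show ?thesis by (rule that)
qed

text \<open>Finitely many clopen sets of small diameter cover the boundary, and a chain of rays with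
  small steps cannot leave a clopen set.\<close>

lemma ray_chain_close:
  fixes x0 :: "'a::metric_space"
  assumes cat: "CAT0 TYPE('a)"
    and hom: "cone_topology x0 homeomorphic_space (top_of_set cantor_set)" and "a > 0" "\<delta> > 0"
  shows "\<exists>T>0. \<exists>e>0. \<forall>c\<in>rays_from x0. \<forall>c'.
     (\<lambda>u v. u \<in> rays_from x0 \<and> v \<in> rays_from x0 \<and> dist (u T) (v T) < e)\<^sup>*\<^sup>* c c'
     \<longrightarrow> dist (c a) (c' a) < \<delta>"
proof -
  define X where "X = cone_topology x0"
  have tX: "topspace X = rays_from x0" by (simp add: X_def topspace_cone_topology)
  have comp: "compact_space X"
    unfolding X_def using homeomorphic_compact_space[OF hom] compact_cantor_set
    by (simp add: compact_space_subtopology)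
  define good where "good U \<longleftrightarrow> openin X U \<and> compactin X U \<and>
    (\<forall>u\<in>U. \<forall>v\<in>U. dist (u a) (v a) < \<delta>)" for U
  have "\<exists>U. good U \<and> c \<in> U" if c: "c \<in> rays_from x0" for c
  proof -
    obtain U where U: "openin X U" "compactin X U" "c \<in> U"
      "U \<subseteq> {c' \<in> rays_from x0. dist (c a) (c' a) < \<delta> / 2}"
      using cantor_boundary_clopen_neighbourhood[OF hom
          openin_cone_topology_basic[OF c, of a "\<delta> / 2"], of c] c assms(3,4) unfolding X_def by auto
    have "dist (u a) (v a) < \<delta>" if "u \<in> U" "v \<in> U" for u v
    proof -
      have "dist (c a) (u a) < \<delta> / 2" "dist (c a) (v a) < \<delta> / 2" using that U(4) by auto
      then show ?thesis using dist_triangle3[of "u a" "v a" "c a"] by simp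
    qed
    then show ?thesis using U good_def by blast
  qed
  then have "\<exists>\<F>. finite \<F> \<and> \<F> \<subseteq> Collect good \<and> topspace X \<subseteq> \<Union>\<F>"
    using comp unfolding compact_space_def
    by (intro compactinD[of X]) (auto simp: good_def tX)
  then obtain F where F: "finite F" "\<And>U. U \<in> F \<Longrightarrow> good U" "rays_from x0 \<subseteq> \<Union>F"
    unfolding tX by (metis Ball_Collect)
  have "\<exists>T e. T > 0 \<and> e > 0 \<and>
      (\<forall>t\<ge>T. \<forall>u\<in>U. \<forall>v\<in>rays_from x0. dist (u t) (v t) < e \<longrightarrow> v \<in> U)" if "U \<in> F" for U
    using clopen_separated[OF cat, of x0 U] F(2)[OF that] unfolding good_def X_def by blast
  then obtain T e where Te: "\<And>U. U \<in> F \<Longrightarrow> T U > 0" "\<And>U. U \<in> F \<Longrightarrow> e U > (0::real)"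
    "\<And>U t u v. U \<in> F \<Longrightarrow> t \<ge> T U \<Longrightarrow> u \<in> U \<Longrightarrow> v \<in> rays_from x0 \<Longrightarrow> dist (u t) (v t) < e U \<Longrightarrow> v \<in> U"
    by metis
  define T0 where "T0 = Max (insert 1 (T ` F))"
  define e0 where "e0 = Min (insert 1 (e ` F))"
  have T0: "T0 \<ge> 1" "\<And>U. U \<in> F \<Longrightarrow> T U \<le> T0" using F(1) by (auto simp: T0_def)
  have e0: "e0 > 0" "\<And>U. U \<in> F \<Longrightarrow> e0 \<le> e U" using F(1) Te(2) by (auto simp: e0_def)
  show ?thesis
  proof (rule exI[of _ T0], intro conjI exI[of _ e0] ballI allI impI)
    show "T0 > 0" "e0 > 0" using T0 e0 by auto
    fix c c' assume c: "c \<in> rays_from x0"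
      and chain: "(\<lambda>u v. u \<in> rays_from x0 \<and> v \<in> rays_from x0 \<and> dist (u T0) (v T0) < e0)\<^sup>*\<^sup>* c c'"
    obtain U where U: "U \<in> F" "c \<in> U" using F(3) c by blast
    from chain have "c' \<in> U"
    proof (induction rule: rtranclp_induct)
      case base
      then show ?case by (rule U(2))
    next
      case (step u v)
      then show ?case using Te(3)[OF U(1) T0(2)[OF U(1)], of u v] e0(2)[OF U(1)] by auto
    qed
    then show "dist (c a) (c' a) < \<delta>" using F(2)[OF U(1)] U(2) by (auto simp: good_def)
  qed
qed

section \<open>Chains and the bottleneck property\<close>

text \<open>The reflexive closure relates every point to itself, even outside \<open>A\<close>;
  hence membership of the starting point in \<open>A\<close> is assumed separately where it
  matters.\<close>

definition chain_connected :: "'a::metric_space set \<Rightarrow> real \<Rightarrow> 'a \<Rightarrow> 'a \<Rightarrow> bool" where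
  "chain_connected A e = (\<lambda>u v. u \<in> A \<and> v \<in> A \<and> dist u v \<le> e)\<^sup>*\<^sup>*"

lemma chain_connected_refl: "chain_connected A e x x"
  by (simp add: chain_connected_def)

lemma chain_connected_step: "x \<in> A \<Longrightarrow> y \<in> A \<Longrightarrow> dist x y \<le> e \<Longrightarrow> chain_connected A e x y"
  by (simp add: chain_connected_def r_into_rtranclp)

lemma chain_connected_trans:
  "chain_connected A e x y \<Longrightarrow> chain_connected A e y z \<Longrightarrow> chain_connected A e x z"
  unfolding chain_connected_def by (rule rtranclp_trans)

lemma chain_connected_sym:
  assumes "chain_connected A e x y"
  shows "chain_connected A e y x"
proof -
  have "symp (\<lambda>u v. u \<in> A \<and> v \<in> A \<and> dist u v \<le> e)"
    by (auto simp: symp_def dist_commute)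
  then have "symp (chain_connected A e)"
    unfolding chain_connected_def by (rule symp_rtranclp)
  then show ?thesis using assms by (rule sympD)
qed

lemma chain_connected_mono:
  assumes "A \<subseteq> B" "chain_connected A e x y"
  shows "chain_connected B e x y"
  using assms(2) unfolding chain_connected_def
  by (rule rtranclp_mono[THEN predicate2D, rotated]) (use assms(1) in auto)

lemma chain_connected_mem:
  assumes "chain_connected A e x y" "x \<in> A"
  shows "y \<in> A"
  using assms unfolding chain_connected_def by (induction rule: rtranclp_induct) auto

lemma chain_connected_image:
  assumes "chain_connected A e x y" "\<And>u v. dist (f u) (f v) = dist u v"
  shows "chain_connected (f ` A) e (f x) (f y)"
  using assms(1) unfolding chain_connected_def
proof (induction rule: rtranclp_induct)
  case (step u v)
  then show ?case using assms(2) by (auto intro!: rtranclp.rtrancl_into_rtrancl[of _ "f x" "f u"])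
qed simp

text \<open>Walk along the segment in steps of length \<open>e\<close>. The relation
  \<open>P\<close> is arbitrary because the result yields chains of points as well as paths in the
  tree.\<close>

lemma geodesic_segment_relpowp:
  assumes g: "geodesic_segment c x y" and e: "e > 0" and n: "dist x y \<le> real n * e"
    and P: "\<And>s t. s \<in> {0..dist x y} \<Longrightarrow> t \<in> {0..dist x y} \<Longrightarrow> \<bar>s - t\<bar> \<le> e \<Longrightarrow> P (c s) (c t)"
  shows "(P ^^ n) x y"
proof -
  have "(P ^^ m) (c 0) (c t)" if "t \<in> {0..dist x y}" "t \<le> real m * e" for t m
    using that
  proof (induction m arbitrary: t)
    case (Suc m)
    \<comment> \<open>Going back by \<open>e\<close> is cut off at 0, so surplus steps stay at the
      start.\<close>
    define s where "s = max 0 (t - e)"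
    have "s \<in> {0..dist x y}" "s \<le> real m * e" "\<bar>s - t\<bar> \<le> e"
      using Suc.prems e by (auto simp: s_def algebra_simps max_def)
    then have "(P ^^ m) (c 0) (c s)" "P (c s) (c t)"
      using Suc.IH P Suc.prems by auto
    then show ?case by auto
  qed auto
  from this[of "dist x y" n] n show ?thesis
    using g by (auto simp: geodesic_segment_def)
qed

lemma geodesic_segment_chain_connected:
  assumes g: "geodesic_segment c x y" and e: "e > 0"
    and A: "\<And>s. s \<in> {0..dist x y} \<Longrightarrow> c s \<in> A"
  shows "chain_connected A e x y"
proof -
  obtain n where "dist x y \<le> real n * e"
    using reals_Archimedean3[OF e, rule_format, of "dist x y"] less_imp_le by blast
  then have "((\<lambda>u v. u \<in> A \<and> v \<in> A \<and> dist u v \<le> e) ^^ n) x y"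
    by (rule geodesic_segment_relpowp[OF g e]) (use A g in \<open>auto simp: geodesic_segment_def\<close>)
  then show ?thesis unfolding chain_connected_def by (rule relpowp_imp_rtranclp)
qed

text \<open>The quantity bounded below is twice the Gromov product based at \<open>x0\<close>.\<close>

lemma chain_connected_outside_ball_gromov_product:
  fixes x0 :: "'a::metric_space"
  assumes gc: "geodesically_complete TYPE('a)" and cat: "CAT0 TYPE('a)"
    and hom: "cone_topology x0 homeomorphic_space (top_of_set cantor_set)"
    and ne: "rays_from x0 \<noteq> {}" and M: "M \<ge> 0"
  shows "\<exists>T>0. \<exists>e>0. \<forall>x y. T \<le> dist x0 x \<longrightarrow> chain_connected {u. T \<le> dist x0 u} e x y \<longrightarrow>
     2 * M < dist x0 x + dist x0 y - dist x y"
proof -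
  \<comment> \<open>The extra 1 absorbs the distance, below 1, between the two rays at time
    \<open>a\<close>.\<close>
  define a where "a = M + 1"
  have "a > 0" using M by (simp add: a_def)
  obtain T1 e1 where T1: "T1 > 0" "e1 > 0"
    "\<And>c c'. c \<in> rays_from x0 \<Longrightarrow>
       (\<lambda>u v. u \<in> rays_from x0 \<and> v \<in> rays_from x0 \<and> dist (u T1) (v T1) < e1)\<^sup>*\<^sup>* c c' \<Longrightarrow>
       dist (c a) (c' a) < 1"
    using ray_chain_close[OF cat hom \<open>a > 0\<close>, of 1] by auto
  have "\<exists>c. c \<in> rays_from x0 \<and> c (dist x0 x) = x" for x
    using ray_through_point[OF gc cat ne, of x] by blast
  then obtain \<rho> where \<rho>: "\<And>x. \<rho> x \<in> rays_from x0" "\<And>x. \<rho> x (dist x0 x) = x" by metis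
  define T where "T = max T1 a"
  define e where "e = e1 / 3"
  \<comment> \<open>Both rays are cut at the smaller radius \<open>m\<close>. This moves the
    endpoints by at most \<open>dist u v\<close> in total, so the rays are within
    \<open>2 * e < e1\<close> at time \<open>m\<close>, hence also at time
    \<open>T1\<close>.\<close>
  have near: "dist (\<rho> u T1) (\<rho> v T1) < e1"
    if "T \<le> dist x0 u" "T \<le> dist x0 v" "dist u v \<le> e" for u v
  proof -
    define m where "m = min (dist x0 u) (dist x0 v)"
    have m: "m \<ge> T1" "m \<ge> 0" using that by (auto simp: m_def T_def)
    have uv: "\<bar>dist x0 u - dist x0 v\<bar> \<le> dist u v"
      using dist_triangle[of x0 u v] dist_triangle[of x0 v u] by (auto simp: dist_commute)
    have "dist (\<rho> u m) u + dist (\<rho> v m) v = \<bar>dist x0 u - dist x0 v\<bar>"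
      using rays_from_dist[OF \<rho>(1)[of u], of m "dist x0 u"] rays_from_dist[OF \<rho>(1)[of v], of m "dist x0 v"]
        m \<rho>(2) by (auto simp: m_def)
    moreover have "dist (\<rho> u m) (\<rho> v m) \<le> dist (\<rho> u m) u + dist u v + dist (\<rho> v m) v"
      using dist_triangle[of "\<rho> u m" "\<rho> v m" u] dist_triangle[of u "\<rho> v m" v]
      by (simp add: dist_commute)
    moreover have "dist (\<rho> u T1) (\<rho> v T1) \<le> dist (\<rho> u m) (\<rho> v m)"
      using m T1(1) by (intro rays_from_dist_mono[OF cat \<rho>(1) \<rho>(1)]) auto
    ultimately show ?thesis using uv that T1(2) by (simp add: e_def)
  qed
  show ?thesis
  proof (rule exI[of _ T], intro conjI exI[of _ e] allI impI)
    show "T > 0" "e > 0" using T1 by (auto simp: T_def e_def)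
    fix x y assume x: "T \<le> dist x0 x" and xy: "chain_connected {u. T \<le> dist x0 u} e x y"
    have y: "T \<le> dist x0 y" using chain_connected_mem[OF xy] x by simp
    \<comment> \<open>Replacing each point by the chosen ray through it turns the chain of points
      into a chain of rays.\<close>
    have "(\<lambda>u v. u \<in> rays_from x0 \<and> v \<in> rays_from x0 \<and> dist (u T1) (v T1) < e1)\<^sup>*\<^sup>* (\<rho> x) (\<rho> y)"
      using xy unfolding chain_connected_def
    proof (induction rule: rtranclp_induct)
      case (step u v)
      then show ?case using near[of u v] \<rho>(1)
        by (auto intro!: rtranclp.rtrancl_into_rtrancl[of _ "\<rho> x" "\<rho> u"])
    qed simp
    from T1(3)[OF \<rho>(1) this] have "dist (\<rho> x a) (\<rho> y a) < 1" .
    moreover have "dist x (\<rho> x a) = dist x0 x - a" "dist (\<rho> y a) y = dist x0 y - a"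
      using rays_from_dist[OF \<rho>(1)[of x], of "dist x0 x" a] rays_from_dist[OF \<rho>(1)[of y], of a "dist x0 y"]
        x y \<open>a > 0\<close> \<rho>(2) by (auto simp: T_def)
    \<comment> \<open>Going from \<open>x\<close> along its ray to time \<open>a\<close>, across,
      and out to \<open>y\<close> takes less than
      \<open>dist x0 x + dist x0 y - 2 * a + 1\<close>.\<close>
    ultimately show "2 * M < dist x0 x + dist x0 y - dist x y"
      using dist_triangle[of x y "\<rho> x a"] dist_triangle[of "\<rho> x a" y "\<rho> y a"] by (simp add: a_def)
  qed
qed

section \<open>Transport by isometries\<close>

lemma isometry_inv:
  assumes "isometry g"
  shows "inv g (g u) = u" "dist (inv g u) (inv g v) = dist u v"
proof -
  have g: "bij g" "\<And>x y. dist (g x) (g y) = dist x y" using assms by (auto simp: isometry_def)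
  have *: "g (inv g u) = u" for u using g(1) by (simp add: bij_is_surj surj_f_inv_f)
  show "inv g (g u) = u" using g(1) by (simp add: bij_is_inj)
  show "dist (inv g u) (inv g v) = dist u v" using g(2)[of "inv g u" "inv g v"] * by simp
qed

text \<open>If \<open>y = g k\<close> with \<open>k\<close> in the compact set, then
  \<open>inv g y = k\<close> lies at bounded distance from \<open>x0\<close>.\<close>

lemma cocompact_bounded_orbit_distance:
  fixes x0 :: "'a::metric_space"
  assumes "cocompact TYPE('a)"
  obtains M where "M \<ge> 0" "\<forall>y. \<exists>g. isometry g \<and> dist x0 (inv g y) \<le> M"
proof -
  obtain K :: "'a set" where K: "compact K" "\<And>y. \<exists>g k. isometry g \<and> k \<in> K \<and> g k = y"
    using assms unfolding cocompact_def by auto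
  obtain M where M: "\<And>k. k \<in> K \<Longrightarrow> dist x0 k \<le> M"
    using compact_imp_bounded[OF K(1)] unfolding bounded_any_center[where a = x0] by blast
  have "\<exists>g. isometry g \<and> dist x0 (inv g y) \<le> max M 0" for y
  proof -
    obtain g k where g: "isometry g" "k \<in> K" "g k = y" using K(2)[of y] by auto
    then have "dist x0 (inv g y) \<le> max M 0" using M isometry_inv(1)[OF g(1), of k] by force
    then show ?thesis using g(1) by blast
  qed
  then show ?thesis by (intro that[of "max M 0"]) auto
qed

text \<open>Suppose \<open>A\<close> stays far from \<open>q\<close>. An isometry carries
  \<open>q\<close> to a point \<open>k\<close> within \<open>M\<close> of \<open>x0\<close>, so the
  image of \<open>A\<close> avoids a large ball about \<open>x0\<close> and the Gromov product of
  the images of \<open>x\<close> and \<open>y\<close> exceeds \<open>M\<close>. But \<open>k\<close>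
  lies metrically between these images, which bounds the product by \<open>M\<close>.\<close>

lemma cantor_boundary_bottleneck:
  fixes x0 :: "'a::metric_space"
  assumes cc: "cocompact TYPE('a)"
    and gc: "geodesically_complete TYPE('a)" and cat: "CAT0 TYPE('a)"
    and hom: "cone_topology x0 homeomorphic_space (top_of_set cantor_set)"
    and ne: "rays_from x0 \<noteq> {}"
  obtains T e where "T > 0" "e > 0"
    "\<And>A q x y::'a. chain_connected A e x y \<Longrightarrow> x \<in> A \<Longrightarrow> dist x q + dist q y = dist x y \<Longrightarrow>
      \<exists>z\<in>A. dist q z < T"
proof -
  obtain M where M: "M \<ge> 0" "\<forall>y. \<exists>g. isometry g \<and> dist x0 (inv g y) \<le> M"
    using cocompact_bounded_orbit_distance[OF cc, of x0] by blast
  obtain T e where T: "T > 0" "e > 0"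
    "\<And>x y. T \<le> dist x0 x \<Longrightarrow> chain_connected {u. T \<le> dist x0 u} e x y \<Longrightarrow>
     2 * M < dist x0 x + dist x0 y - dist x y"
    using chain_connected_outside_ball_gromov_product[OF gc cat hom ne M(1)] by blast
  show ?thesis
  proof (rule that[of "T + M" e])
    show "T + M > 0" "e > 0" using T M by auto
    fix A and q x y :: 'a
    assume xy: "chain_connected A e x y" "x \<in> A" and q: "dist x q + dist q y = dist x y"
    show "\<exists>z\<in>A. dist q z < T + M"
    proof (rule ccontr)
      assume "\<not> ?thesis"
      then have far: "T + M \<le> dist q z" if "z \<in> A" for z using that by force
      obtain g where g: "isometry g" "dist x0 (inv g q) \<le> M" using M(2) by blast
      define i k where "i = inv g" and "k = i q"
      have i: "dist (i u) (i v) = dist u v" for u v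
        unfolding i_def by (rule isometry_inv(2)[OF g(1)])
      have k: "dist k (i u) = dist q u" "dist x0 k \<le> M" for u
        using i g(2) by (auto simp: k_def i_def)
      have sub: "i ` A \<subseteq> {u. T \<le> dist x0 u}"
      proof safe
        fix z assume "z \<in> A"
        then show "T \<le> dist x0 (i z)"
          using far[of z] k(1)[of z] k(2) dist_triangle[of k "i z" x0] by (simp add: dist_commute)
      qed
      have "2 * M < dist x0 (i x) + dist x0 (i y) - dist (i x) (i y)"
        using sub xy(2) chain_connected_mono[OF sub chain_connected_image[OF xy(1) i]]
        by (intro T(3)) auto
      moreover have "dist x0 (i x) \<le> M + dist x q" "dist x0 (i y) \<le> M + dist q y"
        using dist_triangle[of x0 "i x" k] dist_triangle[of x0 "i y" k] k(1)[of x] k(1)[of y] k(2)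
        by (auto simp: dist_commute)
      ultimately show False using q i[of x y] by simp
    qed
  qed
qed

text \<open>A finite net of one large ball about \<open>x0\<close>, moved by isometries, serves
  every ball of radius \<open>r\<close>. This uniformity is what bounds the valence of the
  tree.\<close>

lemma cocompact_proper_uniformly_covered:
  assumes pr: "proper_space TYPE('a::metric_space)" and cc: "cocompact TYPE('a)" and e: "e > 0"
  shows "\<exists>N. \<forall>x::'a. \<exists>F. finite F \<and> card F \<le> N \<and> cball x r \<subseteq> (\<Union>f\<in>F. ball f e)"
proof -
  fix x0 :: 'a
  obtain M where M: "M \<ge> 0" "\<forall>y. \<exists>g. isometry g \<and> dist x0 (inv g y) \<le> M"
    using cocompact_bounded_orbit_distance[OF cc, of x0] by blast
  have "compact (cball x0 (M + r))" using pr by (auto simp: proper_space_def)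
  then obtain F where F: "finite F" "cball x0 (M + r) \<subseteq> (\<Union>f\<in>F. ball f e)"
    using e by (metis compact_eq_totally_bounded)
  show ?thesis
  proof (intro exI[of _ "card F"] allI)
    fix x
    obtain g where g: "isometry g" "dist x0 (inv g x) \<le> M" using M(2) by blast
    note i = isometry_inv[OF g(1)]
    have "cball x r \<subseteq> (\<Union>f\<in>g ` F. ball f e)"
    proof
      fix y assume "y \<in> cball x r"
      then have "dist (inv g x) (inv g y) \<le> r" using i(2) by simp
      then have "inv g y \<in> cball x0 (M + r)"
        using g(2) dist_triangle[of x0 "inv g y" "inv g x"] by simp
      then obtain f where f: "f \<in> F" "dist f (inv g y) < e" using F(2) by auto
      then have "dist (g f) y < e" using i(2)[of "g f" y] i(1)[of f] by simp
      then show "y \<in> (\<Union>f\<in>g ` F. ball f e)" using f(1) by auto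
    qed
    then show "\<exists>F'. finite F' \<and> card F' \<le> card F \<and> cball x r \<subseteq> (\<Union>f\<in>F'. ball f e)"
      using F(1) card_image_le by blast
  qed
qed

section \<open>Graphs with levels\<close>

text \<open>Moves walks from lists to powers of the relation, on which paths are built by
  induction.\<close>

lemma walk_iff_relpowp:
  "(\<exists>xs. is_walk E xs \<and> hd xs = u \<and> last xs = v \<and> length xs = Suc n) \<longleftrightarrow> (E ^^ n) u v"
proof
  assume "\<exists>xs. is_walk E xs \<and> hd xs = u \<and> last xs = v \<and> length xs = Suc n"
  then obtain xs where xs: "is_walk E xs" "hd xs = u" "last xs = v" "length xs = Suc n" by blast
  then have "xs \<noteq> []" by auto
  then have "xs ! 0 = u" "xs ! n = v" using xs by (auto simp: hd_conv_nth last_conv_nth)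
  then show "(E ^^ n) u v" using xs unfolding relpowp_fun_conv is_walk_def
    by (intro exI[of _ "\<lambda>i. xs ! i"]) auto
next
  assume "(E ^^ n) u v"
  then obtain f where f: "f 0 = u" "f n = v" "\<And>i. i < n \<Longrightarrow> E (f i) (f (Suc i))"
    unfolding relpowp_fun_conv by blast
  let ?xs = "map f [0..<Suc n]"
  have "is_walk E ?xs" using f(3) by (auto simp: is_walk_def nth_append less_Suc_eq simp del: upt_Suc)
  moreover have "hd ?xs = u" using f(1) by (simp add: hd_map del: upt_Suc)
  moreover have "last ?xs = v" using f(2) by simp
  ultimately show "\<exists>xs. is_walk E xs \<and> hd xs = u \<and> last xs = v \<and> length xs = Suc n"
    by (intro exI[of _ ?xs]) simp
qed

lemma graph_dist_le:
  assumes "(E ^^ n) u v"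
  shows "graph_dist E u v \<le> n"
  unfolding graph_dist_def walk_iff_relpowp using assms by (rule Least_le)

lemma relpowp_graph_dist:
  assumes "(E ^^ n) u v"
  shows "(E ^^ graph_dist E u v) u v"
  unfolding graph_dist_def walk_iff_relpowp using assms by (rule LeastI)

text \<open>On a cycle, both neighbours of a vertex of maximal level would be its unique lower
  neighbour.\<close>

lemma no_cycle_if_unique_lower_neighbour:
  fixes lv :: "'v \<Rightarrow> nat"
  assumes sym: "\<And>u v. E u v \<Longrightarrow> E v u" and lv: "\<And>u v. E u v \<Longrightarrow> lv u \<noteq> lv v"
    and unique: "\<And>u u' v. E u v \<Longrightarrow> E u' v \<Longrightarrow> lv u < lv v \<Longrightarrow> lv u' < lv v \<Longrightarrow> u = u'"
  shows "\<not> (\<exists>xs. is_walk E xs \<and> distinct xs \<and> length xs \<ge> 3 \<and> E (last xs) (hd xs))"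
proof
  assume "\<exists>xs. is_walk E xs \<and> distinct xs \<and> length xs \<ge> 3 \<and> E (last xs) (hd xs)"
  then obtain xs where xs: "is_walk E xs" "distinct xs" "length xs \<ge> 3" "E (last xs) (hd xs)" by blast
  define n where "n = length xs"
  have n: "n \<ge> 3" using xs by (simp add: n_def)
  have ne: "xs \<noteq> []" using n by (auto simp: n_def)
  have E: "E (xs ! i) (xs ! (Suc i mod n))" if "i < n" for i
  proof (cases "Suc i = n")
    case True
    then have "i = length xs - 1" by (simp add: n_def)
    then have "xs ! i = last xs" "xs ! (Suc i mod n) = hd xs"
      using True ne by (auto simp: hd_conv_nth last_conv_nth)
    then show ?thesis using xs(4) by simp
  next
    case False
    then show ?thesis using xs(1) that by (simp add: is_walk_def n_def)
  qed
  obtain i where i: "i < n" "\<And>j. j < n \<Longrightarrow> lv (xs ! j) \<le> lv (xs ! i)"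
  proof -
    have "Max (lv ` set xs) \<in> lv ` set xs" using ne by (intro Max_in) auto
    then obtain i where "i < n" "lv (xs ! i) = Max (lv ` set xs)"
      by (metis (no_types, lifting) imageE in_set_conv_nth n_def)
    then show ?thesis using that[of i] by (auto simp: n_def)
  qed
  \<comment> \<open>\<open>j\<close> and \<open>k\<close> are the cyclic successor and predecessor
    of \<open>i\<close>; they differ because the cycle has at least three vertices.\<close>
  define j k where "j = Suc i mod n" and "k = (if i = 0 then n - 1 else i - 1)"
  have jk: "j < n" "k < n" "Suc k mod n = i" using i n by (auto simp: j_def k_def)
  have "j \<noteq> k" using i n by (cases "Suc i = n") (auto simp: j_def k_def)
  have "E (xs ! j) (xs ! i)" using sym[OF E[OF i(1)]] by (simp add: j_def)
  moreover have "E (xs ! k) (xs ! i)" using E[OF jk(2)] jk(3) by simp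
  ultimately have "xs ! j = xs ! k"
    using i(2)[OF jk(1)] i(2)[OF jk(2)] lv by (intro unique[of _ "xs ! i"]) (auto simp: le_neq_implies_less)
  then show False using \<open>j \<noteq> k\<close> jk xs(2) by (simp add: nth_eq_iff_index_eq n_def)
qed

section \<open>The tree of chain components\<close>

text \<open>Collects the coarse consequences from which the tree is built. The rays through all
  points provide parents and children, and the line through \<open>p\<close> gives the root two
  children.\<close>

locale bottleneck_space =
  fixes p :: "'a::metric_space" and T e :: real
  assumes geodesic: "geodesic_metric_space TYPE('a)"
    and T: "T > 0" and e: "e > 0"
    and bottleneck: "\<And>A q x y::'a. chain_connected A e x y \<Longrightarrow> x \<in> A \<Longrightarrow>
      dist x q + dist q y = dist x y \<Longrightarrow> \<exists>z\<in>A. dist q z < T"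
    and covered: "\<And>r \<epsilon>. \<epsilon> > 0 \<Longrightarrow>
      \<exists>N. \<forall>x::'a. \<exists>F. finite F \<and> card F \<le> N \<and> cball x r \<subseteq> (\<Union>f\<in>F. ball f \<epsilon>)"
    and ray_through: "\<And>x. \<exists>c\<in>rays_from p. c (dist p x) = x"
    and line_through: "\<exists>l. geodesic_line l \<and> l 0 = p"
begin

lemma geodesic_segment_to:
  obtains c where "geodesic_segment c x (y::'a)"
  by (rule geodesic_segment_exists[OF geodesic])

text \<open>A chain outside the ball of radius \<open>r\<close> keeps the midpoint of \<open>x\<close> and \<open>y\<close> away from
  \<open>p\<close>, while the chain through \<open>p\<close> along the two radii draws it towards \<open>p\<close>.\<close>

lemma sphere_chain_connected_close:
  assumes x: "dist p x = r" and y: "dist p y = r"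
    and xy: "chain_connected {u. r \<le> dist p u} e x y"
  shows "dist x y < 6 * T"
proof -
  obtain c where c: "geodesic_segment c x y" by (rule geodesic_segment_to)
  define q where "q = c (dist x y / 2)"
  have c': "c 0 = x" "c (dist x y) = y"
    "\<And>s t. s \<in> {0..dist x y} \<Longrightarrow> t \<in> {0..dist x y} \<Longrightarrow> dist (c s) (c t) = \<bar>s - t\<bar>"
    using c by (auto simp: geodesic_segment_def)
  have q: "dist x q = dist x y / 2" "dist q y = dist x y / 2"
    using c'(3)[of 0 "dist x y / 2"] c'(3)[of "dist x y / 2" "dist x y"] c'(1,2) by (auto simp: q_def)
  obtain z where z: "r \<le> dist p z" "dist q z < T"
    using bottleneck[OF xy, of q] x q by auto
  have far: "r - T < dist p q" using z dist_triangle[of p z q] by simp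
  \<comment> \<open>\<open>A\<close> consists of the points on geodesics from \<open>p\<close> to
    \<open>x\<close> or to \<open>y\<close>.\<close>
  define A where "A = {z. dist p z + dist z x = r \<or> dist p z + dist z y = r}"
  have to_p: "chain_connected A e p w" if w: "w = x \<or> w = y" for w
  proof -
    obtain b where b: "geodesic_segment b p w" by (rule geodesic_segment_to)
    then have b': "b 0 = p" "b (dist p w) = w"
      "\<And>s t. s \<in> {0..dist p w} \<Longrightarrow> t \<in> {0..dist p w} \<Longrightarrow> dist (b s) (b t) = \<bar>s - t\<bar>"
      by (auto simp: geodesic_segment_def)
    have "b s \<in> A" if s: "s \<in> {0..dist p w}" for s
    proof -
      have "dist p (b s) = s" "dist (b s) w = dist p w - s"
        using b'(3)[of 0 s] b'(3)[of s "dist p w"] b'(1,2) s by auto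
      then show ?thesis using w x y by (auto simp: A_def)
    qed
    then show ?thesis by (rule geodesic_segment_chain_connected[OF b e])
  qed
  have "chain_connected A e x y"
    using chain_connected_trans[OF chain_connected_sym[OF to_p[of x]] to_p[of y]] by simp
  moreover have "x \<in> A" using x by (simp add: A_def)
  ultimately obtain w where w: "w \<in> A" "dist q w < T" using bottleneck[of A x y q] q by auto
  \<comment> \<open>\<open>w\<close> lies on a radius, at least \<open>dist x y / 2 - T\<close> away
    from its outer end.\<close>
  then have "dist p w \<le> r - dist x y / 2 + T"
    using q dist_triangle[of q x w] dist_triangle[of q y w] by (auto simp: A_def dist_commute)
  moreover have "dist p q \<le> dist p w + T"
    using w(2) dist_triangle[of p q w] by (simp add: dist_commute)
  ultimately show ?thesis using far by simp
qed

text \<open>The width of a level: as \<open>e < R\<close>, one chain step changes the level by at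
  most one, and as \<open>T < R\<close>, a chain outside the ball of radius \<open>R\<close> stays
  out of the bottleneck ball about \<open>p\<close>.\<close>

definition R where "R = T + e"

definition outside where "outside n = {u. real n * R \<le> dist p u}"

definition level where "level x = nat \<lfloor>dist p x / R\<rfloor>"

definition conn where "conn n = chain_connected (outside n) e"

text \<open>The vertices are pairs of a level and a chain component outside the ball of that radius,
  numbered by an injection into \<open>nat\<close>.\<close>

definition component where "component x = (level x, {y. conn (level x) x y})"

definition node :: "'a \<Rightarrow> nat" where "node x = to_nat_on (range component) (component x)"

text \<open>Inclusion of components of consecutive levels: as \<open>outside\<close> shrinks with
  the level, the component of \<open>y\<close> lies in that of \<open>x\<close> once the two points
  are joined at the lower level.\<close>

definition is_parent where
  "is_parent u v \<longleftrightarrow> (\<exists>x y. u = node x \<and> v = node y \<and> level y = Suc (level x) \<and> conn (level x) x y)"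

definition adj where "adj u v \<longleftrightarrow> is_parent u v \<or> is_parent v u"

text \<open>The choice of a representative is harmless, since points with the same node have the
  same level.\<close>

definition node_level where "node_level v = level (SOME x. node x = v)"

section \<open>Levels, components and the parent relation\<close>

lemma R_pos: "R > 0" and T_less_R: "T < R" and e_less_R: "e < R"
  using T e by (auto simp: R_def)

lemma level_eq_iff: "level x = n \<longleftrightarrow> real n * R \<le> dist p x \<and> dist p x < real n * R + R"
proof -
  have "0 \<le> dist p x / R" using R_pos by simp
  then have "level x = n \<longleftrightarrow> \<lfloor>dist p x / R\<rfloor> = int n"
    unfolding level_def using zero_le_floor[of "dist p x / R"] by linarith
  also have "\<dots> \<longleftrightarrow> real n * R \<le> dist p x \<and> dist p x < real n * R + R"
    using R_pos by (simp add: floor_eq_iff field_simps)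
  finally show ?thesis .
qed

lemma level_bounds: "real (level x) * R \<le> dist p x" "dist p x < real (level x) * R + R"
  using level_eq_iff[of x "level x"] by simp_all

lemma outside_antimono:
  assumes "m \<le> n"
  shows "outside n \<subseteq> outside m"
proof -
  have "real m * R \<le> real n * R" using assms R_pos by (intro mult_right_mono) auto
  then show ?thesis by (auto simp: outside_def)
qed

lemma in_outside_level: "n \<le> level x \<Longrightarrow> x \<in> outside n"
  using subsetD[OF outside_antimono, of n "level x" x] level_bounds(1)[of x]
  by (simp add: outside_def)

lemma conn_mono: "m \<le> n \<Longrightarrow> conn n x y \<Longrightarrow> conn m x y"
  unfolding conn_def by (rule chain_connected_mono[OF outside_antimono])

lemma conn_refl: "conn n x x"
  by (simp add: conn_def chain_connected_refl)

lemma conn_sym: "conn n x y \<Longrightarrow> conn n y x"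
  unfolding conn_def by (rule chain_connected_sym)

lemma conn_trans: "conn n x y \<Longrightarrow> conn n y z \<Longrightarrow> conn n x z"
  unfolding conn_def by (rule chain_connected_trans)

lemma component_eq_iff: "component x = component y \<longleftrightarrow> level x = level y \<and> conn (level x) x y"
proof
  assume "component x = component y"
  then have "level x = level y" "{z. conn (level x) x z} = {z. conn (level y) y z}"
    by (auto simp: component_def)
  then show "level x = level y \<and> conn (level x) x y" using conn_refl by auto
next
  assume a: "level x = level y \<and> conn (level x) x y"
  then have "conn (level x) x z \<longleftrightarrow> conn (level x) y z" for z
    using conn_trans[of "level x" x y z] conn_trans[OF conn_sym, of "level x" x y z] by blast
  then show "component x = component y" using a by (simp add: component_def)
qed

lemma close_imp_conn:
  assumes "dist x y \<le> e" "n \<le> level x" "n \<le> level y"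
  shows "conn n x y"
  unfolding conn_def using assms in_outside_level by (intro chain_connected_step) auto

text \<open>Two points of one level near the same point of a countable net form a single chain step,
  so a level and a net point determine a component. Countability makes the numbering in
  \<open>node\<close> injective.\<close>

lemma countable_components: "countable (range component)"
proof -
  have "\<exists>F. finite F \<and> cball p (real n) \<subseteq> (\<Union>f\<in>F. ball f (e / 2))" for n
    using covered[of "e / 2" "real n"] e half_gt_zero by meson
  then obtain F where F: "\<And>n. finite (F n)" "\<And>n. cball p (real n) \<subseteq> (\<Union>f\<in>F n. ball f (e / 2))"
    by metis
  define D where "D = (\<Union>n. F n)"
  define S where "S = (\<lambda>(n, f). component ` {y. level y = n \<and> dist f y < e / 2})"
  have "countable (S nf)" for nf
  proof -
    obtain n f where nf: "nf = (n, f)" by fastforce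
    have "c = c'" if cc: "c \<in> S nf" "c' \<in> S nf" for c c'
    proof -
      obtain y y' where y: "c = component y" "c' = component y'" "level y = n" "level y' = n"
        "dist f y < e / 2" "dist f y' < e / 2"
        using cc by (auto simp: S_def nf)
      then have "dist y y' \<le> e" using dist_triangle3[of y y' f] by simp
      then show ?thesis using y close_imp_conn by (simp add: component_eq_iff)
    qed
    then have "S nf = {} \<or> (\<exists>c. S nf = {c})" by blast
    then show ?thesis by auto
  qed
  moreover have "countable D" unfolding D_def using F(1) by (auto intro: countable_finite)
  ultimately have "countable (\<Union>nf\<in>UNIV \<times> D. S nf)" by (intro countable_UN) auto
  moreover have "range component \<subseteq> (\<Union>nf\<in>UNIV \<times> D. S nf)"
  proof (rule image_subsetI)
    fix y
    obtain n where "dist p y \<le> real n" using real_arch_simple by blast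
    then have "y \<in> (\<Union>f\<in>F n. ball f (e / 2))" using F(2)[of n] by (meson mem_cball subsetD)
    then obtain f where "f \<in> D" "dist f y < e / 2" by (auto simp: D_def)
    then show "component y \<in> (\<Union>nf\<in>UNIV \<times> D. S nf)"
      by (intro UN_I[of "(level y, f)"]) (auto simp: S_def)
  qed
  ultimately show ?thesis by (rule countable_subset[rotated])
qed

lemma node_eq_iff: "node x = node y \<longleftrightarrow> level x = level y \<and> conn (level x) x y"
  unfolding node_def component_eq_iff[symmetric]
  by (rule inj_on_eq_iff[OF inj_on_to_nat_on[OF countable_components]]) simp_all

lemma node_level_node: "node_level (node x) = level x"
proof -
  have "node (SOME y. node y = node x) = node x" by (rule someI) simp
  then show ?thesis by (simp add: node_level_def node_eq_iff)
qed

text \<open>Independence of the representatives: a chain between representatives of the upper node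
  is also a chain at the lower level.\<close>

lemma is_parent_node_iff:
  "is_parent (node x) (node y) \<longleftrightarrow> level y = Suc (level x) \<and> conn (level x) x y"
proof
  assume "is_parent (node x) (node y)"
  then obtain x' y' where *: "node x = node x'" "node y = node y'" "level y' = Suc (level x')"
    "conn (level x') x' y'" by (auto simp: is_parent_def)
  have x: "conn (level x') x x'" using *(1) by (auto simp: node_eq_iff)
  have "conn (level y') y y'" using *(2) by (auto simp: node_eq_iff)
  then have y: "conn (level x') y y'" by (rule conn_mono[rotated]) (simp add: *(3))
  show "level y = Suc (level x) \<and> conn (level x) x y"
    using * conn_trans[OF conn_trans[OF x *(4)] conn_sym[OF y]] by (auto simp: node_eq_iff)
qed (auto simp: is_parent_def)

lemma is_parent_range: "is_parent u v \<Longrightarrow> u \<in> range node \<and> v \<in> range node"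
  by (auto simp: is_parent_def)

lemma is_parent_node_level: "is_parent u v \<Longrightarrow> node_level v = Suc (node_level u)"
  by (auto simp: is_parent_def node_level_node)

text \<open>Both parent components contain a point representing \<open>v\<close>, and components of
  one level that meet are equal.\<close>

lemma is_parent_unique:
  assumes "is_parent u v" "is_parent u' v"
  shows "u = u'"
proof -
  obtain x y where u: "u = node x" "v = node y"
    using assms(1) by (auto simp: is_parent_def)
  obtain x' where u': "u' = node x'"
    using assms(2) by (auto simp: is_parent_def)
  have x: "level x = level x'" "conn (level x) x y" "conn (level x) x' y"
    using assms unfolding u u' by (auto simp: is_parent_node_iff)
  then show ?thesis using u u' conn_trans[OF x(2) conn_sym[OF x(3)]] by (simp add: node_eq_iff)
qed

lemma adj_range: "adj u v \<Longrightarrow> u \<in> range node \<and> v \<in> range node"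
  unfolding adj_def using is_parent_range by blast

lemma adj_sym: "adj u v \<Longrightarrow> adj v u"
  by (auto simp: adj_def)

lemma adj_node_level: "adj u v \<Longrightarrow> node_level v = Suc (node_level u) \<or> node_level u = Suc (node_level v)"
  by (auto simp: adj_def dest: is_parent_node_level)

text \<open>Follow a ray through \<open>x\<close> back to radius \<open>n * R\<close>; the piece in
  between stays outside that radius and gives the chain.\<close>

lemma point_below:
  assumes "n \<le> level x"
  obtains x' where "dist p x' = real n * R" "level x' = n" "dist x' x = dist p x - real n * R"
    "conn n x' x"
proof -
  obtain c where c: "c \<in> rays_from p" "c (dist p x) = x" using ray_through by blast
  have n: "real n * R \<le> dist p x" "0 \<le> real n * R"
    using in_outside_level[OF assms] R_pos by (auto simp: outside_def)
  define x' where "x' = c (real n * R)"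
  have d: "dist p x' = real n * R" unfolding x'_def by (rule rays_from_dist_base[OF c(1) n(2)])
  have d': "dist x' x = dist p x - real n * R"
    using rays_from_dist[OF c(1) n(2), of "dist p x"] c(2) n by (simp add: x'_def)
  have "geodesic_segment (\<lambda>s. c (real n * R + s)) x' x"
    unfolding geodesic_segment_def d' using rays_from_dist[OF c(1)] c(2) n by (auto simp: x'_def)
  then have "conn n x' x" unfolding conn_def
  proof (rule geodesic_segment_chain_connected[OF _ e])
    fix s assume "s \<in> {0..dist x' x}"
    then show "c (real n * R + s) \<in> outside n"
      using rays_from_dist_base[OF c(1), of "real n * R + s"] n by (simp add: outside_def)
  qed
  moreover have "level x' = n" using d R_pos by (simp add: level_eq_iff)
  ultimately show ?thesis using that d d' by blast
qed

text \<open>Descend from both points to the sphere of radius \<open>n * R\<close>, at a cost of at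
  most \<open>2 * R\<close> each, and apply the bound \<open>6 * T\<close> there.\<close>

lemma conn_imp_close:
  assumes "conn n x y" "n \<le> level x" "level x \<le> Suc n" "n \<le> level y" "level y \<le> Suc n"
  shows "dist x y \<le> 6 * T + 4 * R"
proof -
  obtain x' where x': "dist p x' = real n * R" "dist x' x = dist p x - real n * R" "conn n x' x"
    using point_below[OF assms(2)] by blast
  obtain y' where y': "dist p y' = real n * R" "dist y' y = dist p y - real n * R" "conn n y' y"
    using point_below[OF assms(4)] by blast
  have "conn n x' y'" by (rule conn_trans[OF conn_trans[OF x'(3) assms(1)] conn_sym[OF y'(3)]])
  then have "dist x' y' < 6 * T"
    using x'(1) y'(1) sphere_chain_connected_close by (simp add: conn_def outside_def)
  moreover have "dist p z - real n * R \<le> 2 * R" if "level z \<le> Suc n" for z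
  proof -
    have "real (level z) * R \<le> real (Suc n) * R" using that R_pos by (intro mult_right_mono) auto
    then show ?thesis using level_bounds(2)[of z] by (simp add: algebra_simps)
  qed
  then have "dist x' x \<le> 2 * R" "dist y' y \<le> 2 * R" using x'(2) y'(2) assms by auto
  ultimately show ?thesis
    using dist_triangle[of x y x'] dist_triangle[of x' y y'] by (simp add: dist_commute)
qed

section \<open>The tree metric compared with the metric of the space\<close>

lemma node_eq_imp_close: "node x = node y \<Longrightarrow> dist x y \<le> 6 * T + 4 * R"
  by (rule conn_imp_close[of "level x"]) (auto simp: node_eq_iff)

lemma is_parent_imp_close: "is_parent (node x) (node y) \<Longrightarrow> dist x y \<le> 6 * T + 4 * R"
  by (rule conn_imp_close[of "level x"]) (auto simp: is_parent_node_iff)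

lemma adj_imp_close: "adj (node x) (node y) \<Longrightarrow> dist x y \<le> 6 * T + 4 * R"
  using is_parent_imp_close[of x y] is_parent_imp_close[of y x] by (auto simp: adj_def dist_commute)

lemma close_imp_adj:
  assumes "dist x y \<le> e"
  shows "node x = node y \<or> adj (node x) (node y)"
proof -
  have *: "node x = node y \<or> adj (node x) (node y)"
    if xy: "dist x y \<le> e" "level x \<le> level y" for x y
  proof -
    have c: "conn (level x) x y" using close_imp_conn xy by simp
    \<comment> \<open>A step of length at most \<open>e < R\<close> cannot climb two levels.\<close>
    have "dist p y < real (Suc (Suc (level x))) * R"
      using xy(1) dist_triangle[of p y x] level_bounds(2)[of x] e_less_R by (simp add: algebra_simps)
    then have "real (level y) * R < real (Suc (Suc (level x))) * R"
      using level_bounds(1)[of y] by linarith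
    then have "level y < Suc (Suc (level x))"
      using R_pos by (simp only: mult_less_cancel_right_pos of_nat_less_iff)
    then have "level y = level x \<or> level y = Suc (level x)" using xy(2) by auto
    then show ?thesis using c by (auto simp: node_eq_iff adj_def is_parent_node_iff)
  qed
  show ?thesis
    using *[of x y] *[of y x] assms adj_sym by (cases "level x \<le> level y") (auto simp: dist_commute)
qed

text \<open>Each step of length at most \<open>e\<close> along a geodesic crosses at most one edge;
  steps that stay in one node are dropped, so \<open>m\<close> may be smaller than
  \<open>n\<close>.\<close>

lemma path_in_tree:
  assumes "dist x y \<le> real n * e"
  shows "\<exists>m\<le>n. (adj ^^ m) (node x) (node y)"
proof -
  obtain c where c: "geodesic_segment c x y" by (rule geodesic_segment_to)
  have "((\<lambda>u v. node u = node v \<or> adj (node u) (node v)) ^^ n) x y"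
    by (rule geodesic_segment_relpowp[OF c e assms])
      (use c close_imp_adj in \<open>auto simp: geodesic_segment_def\<close>)
  then show ?thesis
  proof (induction n arbitrary: y)
    case (Suc n)
    then obtain z where z: "((\<lambda>u v. node u = node v \<or> adj (node u) (node v)) ^^ n) x z"
      "node z = node y \<or> adj (node z) (node y)"
      by auto
    obtain m where "m \<le> n" "(adj ^^ m) (node x) (node z)" using Suc.IH[OF z(1)] by blast
    with z(2) show ?case by (metis Suc_le_mono le_SucI relpowp_Suc_I)
  qed simp
qed

lemma graph_dist_upper: "real (graph_dist adj (node x) (node y)) \<le> dist x y / e + 1"
proof -
  \<comment> \<open>Rounding up costs the additive 1.\<close>
  define n where "n = nat \<lceil>dist x y / e\<rceil>"
  have "0 \<le> dist x y / e" using e by simp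
  then have n: "dist x y / e \<le> real n" "real n \<le> dist x y / e + 1" unfolding n_def by linarith+
  then have "dist x y \<le> real n * e" using e by (simp add: field_simps)
  then obtain m where "m \<le> n" "(adj ^^ m) (node x) (node y)" using path_in_tree by blast
  then have "graph_dist adj (node x) (node y) \<le> n"
    using graph_dist_le[of m adj "node x" "node y"] by simp
  then show ?thesis using n by linarith
qed

text \<open>The extra 1 in the factor accounts for two points of one node, which may be apart
  already for \<open>m = 0\<close>.\<close>

lemma relpowp_adj_imp_close:
  "(adj ^^ m) (node x) (node y) \<Longrightarrow> dist x y \<le> (real m + 1) * (6 * T + 4 * R)"
proof (induction m arbitrary: y)
  case 0
  then show ?case using node_eq_imp_close by simp
next
  case (Suc m)
  then obtain v where v: "(adj ^^ m) (node x) v" "adj v (node y)" by auto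
  then obtain z where z: "v = node z" using is_parent_range by (auto simp: adj_def)
  then have "dist x z \<le> (real m + 1) * (6 * T + 4 * R)" "dist z y \<le> 6 * T + 4 * R"
    using Suc.IH v adj_imp_close by auto
  then show ?case using dist_triangle[of x y z] by (simp add: algebra_simps)
qed

lemma graph_dist_lower:
  "dist x y \<le> (real (graph_dist adj (node x) (node y)) + 1) * (6 * T + 4 * R)"
proof -
  obtain n where "dist x y \<le> real n * e"
    using reals_Archimedean3[OF e, rule_format, of "dist x y"] less_imp_le by blast
  then obtain m where "(adj ^^ m) (node x) (node y)" using path_in_tree by blast
  then show ?thesis by (intro relpowp_adj_imp_close relpowp_graph_dist)
qed

lemma quasi_isometry_node:
  "quasi_isometry UNIV dist (range node) (\<lambda>u v. real (graph_dist adj u v)) node"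
proof -
  define B where "B = 6 * T + 4 * R"
  \<comment> \<open>\<open>B\<close> governs the lower estimate and \<open>1 / e\<close> the upper
    one; the additive constant is 1 in both.\<close>
  define L where "L = max 1 (max B (1 / e))"
  have L: "L \<ge> 1" "B \<le> L" "1 / e \<le> L" by (auto simp: L_def)
  have lower: "dist x y / L - 1 \<le> real (graph_dist adj (node x) (node y))" for x y
  proof -
    have "dist x y \<le> (real (graph_dist adj (node x) (node y)) + 1) * L"
      using graph_dist_lower[of x y] mult_left_mono[OF L(2)] unfolding B_def[symmetric]
      by (smt (verit) of_nat_0_le_iff)
    then show ?thesis using L(1) by (simp add: field_simps)
  qed
  have upper: "real (graph_dist adj (node x) (node y)) \<le> L * dist x y + 1" for x y
    using graph_dist_upper[of x y] mult_right_mono[OF L(3) zero_le_dist[of x y]] by simp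
  have "graph_dist adj (node x) (node x) = 0" for x
    using graph_dist_le[of 0 adj "node x" "node x"] by simp
  then have onto: "\<exists>y. real (graph_dist adj (node x) (node y)) \<le> 1" for x
    by (intro exI[of _ x]) simp
  show ?thesis unfolding quasi_isometry_def
    by (rule conjI, simp, rule exI[of _ L], rule exI[of _ 1]) (use L(1) lower upper onto in auto)
qed

text \<open>Geodesics of the space give connectedness. There are no cycles because a neighbour of
  lower level is the parent, which is unique.\<close>

lemma simplicial_tree_node: "simplicial_tree (range node) adj"
proof -
  have "\<exists>xs. is_walk adj xs \<and> hd xs = node x \<and> last xs = node y" for x y
  proof -
    obtain n where "dist x y \<le> real n * e"
      using reals_Archimedean3[OF e, rule_format, of "dist x y"] less_imp_le by blast
    then obtain m where "(adj ^^ m) (node x) (node y)" using path_in_tree by blast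
    then show ?thesis unfolding walk_iff_relpowp[symmetric] by blast
  qed
  moreover have "u \<in> range node \<and> v \<in> range node \<and> adj v u \<and> u \<noteq> v" if "adj u v" for u v
    using adj_range[OF that] adj_sym[OF that] adj_node_level[OF that] by auto
  moreover have "\<not> (\<exists>xs. is_walk adj xs \<and> distinct xs \<and> length xs \<ge> 3 \<and> adj (last xs) (hd xs))"
  proof (rule no_cycle_if_unique_lower_neighbour[where lv = node_level])
    fix u v u' assume "adj u v" "adj u' v" "node_level u < node_level v" "node_level u' < node_level v"
    then have "is_parent u v" "is_parent u' v" by (auto simp: adj_def dest: is_parent_node_level)
    then show "u = u'" by (rule is_parent_unique)
  qed (use adj_sym adj_node_level in fastforce)+
  ultimately show ?thesis unfolding simplicial_tree_def by blast
qed

section \<open>Degrees: no leaves and bounded valence\<close>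

lemma child_exists: "\<exists>v. is_parent (node x) v"
proof -
  obtain c where c: "c \<in> rays_from p" "c (dist p x) = x" using ray_through by blast
  \<comment> \<open>The ray through \<open>x\<close> is followed outwards to the inner radius of the
    next level.\<close>
  define t where "t = real (Suc (level x)) * R"
  have t: "0 \<le> t" "dist p x \<le> t"
    using level_bounds[of x] R_pos by (auto simp: t_def algebra_simps)
  have "level (c t) = Suc (level x)"
    using rays_from_dist_base[OF c(1) t(1)] R_pos unfolding level_eq_iff t_def by simp
  moreover have "conn (level x) x (c t)" unfolding conn_def
  proof (rule geodesic_segment_chain_connected[OF _ e])
    have d: "dist x (c t) = t - dist p x"
      using rays_from_dist[OF c(1) zero_le_dist[of p x] t(1)] c(2) t by simp
    show "geodesic_segment (\<lambda>s. c (dist p x + s)) x (c t)"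
      unfolding geodesic_segment_def d using rays_from_dist[OF c(1)] c(2) t by auto
    fix s assume "s \<in> {0..dist x (c t)}"
    then show "c (dist p x + s) \<in> outside (level x)"
      using rays_from_dist_base[OF c(1), of "dist p x + s"] level_bounds(1)[of x] by (simp add: outside_def)
  qed
  ultimately have "is_parent (node x) (node (c t))" by (simp add: is_parent_node_iff)
  then show ?thesis by blast
qed

lemma parent_exists:
  assumes "level x > 0"
  shows "\<exists>u. is_parent u (node x)"
proof -
  obtain x' where "level x' = level x - 1" "conn (level x - 1) x' x"
    using point_below[of "level x - 1" x] by auto
  then have "is_parent (node x') (node x)" using assms by (simp add: is_parent_node_iff)
  then show ?thesis by blast
qed

lemma conn_0: "conn 0 x y"
proof -
  obtain c where "geodesic_segment c x y" by (rule geodesic_segment_to)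
  then show ?thesis unfolding conn_def
    by (rule geodesic_segment_chain_connected[OF _ e]) (simp add: outside_def)
qed

text \<open>The points of level 0 form a single node, the root. Two points at distance
  \<open>R\<close> from \<open>p\<close> in opposite directions on a line lie in different
  components, for a chain between them has to pass within \<open>T < R\<close> of
  \<open>p\<close>.\<close>

lemma root_children:
  assumes "level x = 0"
  shows "\<exists>v w. v \<noteq> w \<and> is_parent (node x) v \<and> is_parent (node x) w"
proof -
  obtain l where l: "\<And>s t. dist (l s) (l t) = \<bar>s - t\<bar>" "l 0 = p"
    using line_through by (auto simp: geodesic_line_def)
  have d: "dist p (l R) = R" "dist p (l (- R)) = R"
    using l(1)[of 0 R] l(1)[of 0 "- R"] l(2) R_pos by auto
  then have lev: "level (l R) = Suc 0" "level (l (- R)) = Suc 0"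
    using R_pos by (auto simp: level_eq_iff)
  have "\<not> conn 1 (l R) (l (- R))"
  proof
    assume c: "conn 1 (l R) (l (- R))"
    have "dist (l R) p + dist p (l (- R)) = dist (l R) (l (- R))"
      using d l(1)[of R "- R"] R_pos by (simp add: dist_commute)
    then obtain z where "z \<in> outside 1" "dist p z < T"
      using bottleneck[OF c[unfolded conn_def], of p] d by (auto simp: outside_def)
    then show False using T_less_R by (simp add: outside_def)
  qed
  then have "node (l R) \<noteq> node (l (- R))" using lev by (simp add: node_eq_iff)
  moreover have "is_parent (node x) (node (l R))" "is_parent (node x) (node (l (- R)))"
    using lev assms conn_0 by (auto simp: is_parent_node_iff)
  ultimately show ?thesis by blast
qed

text \<open>Away from the root, a parent and a child are distinct because their levels
  differ.\<close>

lemma two_neighbours: "\<exists>v w. v \<noteq> w \<and> adj (node x) v \<and> adj (node x) w"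
proof (cases "level x = 0")
  case True
  then show ?thesis using root_children[of x] unfolding adj_def by blast
next
  case False
  obtain u where u: "is_parent u (node x)" using parent_exists False by blast
  obtain v where v: "is_parent (node x) v" using child_exists by blast
  have "u \<noteq> v" using is_parent_node_level[OF u] is_parent_node_level[OF v] by auto
  then show ?thesis using u v by (auto simp: adj_def)
qed

text \<open>Each neighbour has a representative in a ball of fixed radius about \<open>x\<close> and
  is determined by its level and a nearby net point; two levels and at most \<open>N\<close> net
  points are possible.\<close>

lemma bounded_degree:
  "\<exists>N. \<forall>v\<in>range node. finite {w \<in> range node. adj v w} \<and> degree (range node) adj v \<le> N"
proof -
  define B where "B = 6 * T + 4 * R"
  obtain N where N: "\<forall>x::'a. \<exists>F. finite F \<and> card F \<le> N \<and> cball x B \<subseteq> (\<Union>f\<in>F. ball f (e / 2))"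
    using covered[OF half_gt_zero[OF e], of B] by blast
  have "finite {w \<in> range node. adj (node x) w} \<and> card {w \<in> range node. adj (node x) w} \<le> 2 * N" for x
  proof -
    obtain F where F: "finite F" "card F \<le> N" "cball x B \<subseteq> (\<Union>f\<in>F. ball f (e / 2))" using N by blast
    define W where "W = {w \<in> range node. adj (node x) w}"
    define y where "y w = (SOME z. node z = w)" for w
    have y: "node (y w) = w" if "w \<in> W" for w
      using that someI[of "\<lambda>z. node z = w"] unfolding y_def W_def by blast
    have "\<exists>f. f \<in> F \<and> dist f (y w) < e / 2" if "w \<in> W" for w
    proof -
      have "y w \<in> cball x B"
        using that y[OF that] adj_imp_close[of x "y w"] by (simp add: B_def W_def)
      then have "y w \<in> (\<Union>f\<in>F. ball f (e / 2))" using F(3) by (rule subsetD[rotated])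
      then show ?thesis by auto
    qed
    then obtain f where f: "\<And>w. w \<in> W \<Longrightarrow> f w \<in> F" "\<And>w. w \<in> W \<Longrightarrow> dist (f w) (y w) < e / 2" by metis
    \<comment> \<open>At level 0 the truncated difference \<open>level x - 1\<close> is 0, which
      only enlarges the index set.\<close>
    define I where "I = {level x - 1, level x + 1} \<times> F"
    have I: "finite I" "card I \<le> 2 * N"
    proof -
      show "finite I" using F(1) by (simp add: I_def)
      have "card {level x - 1, level x + 1} \<le> 2" by (simp add: card_insert_if)
      then show "card I \<le> 2 * N" unfolding I_def card_cartesian_product using F(2) by (intro mult_le_mono)
    qed
    have "inj_on (\<lambda>w. (node_level w, f w)) W"
    proof (rule inj_onI)
      fix w w' assume w: "w \<in> W" "w' \<in> W" "(node_level w, f w) = (node_level w', f w')"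
      have "dist (y w) (y w') \<le> e"
        using f(2)[OF w(1)] f(2)[OF w(2)] w(3) dist_triangle3[of "y w" "y w'" "f w"] by simp
      moreover have "level (y w) = level (y w')"
        using w y node_level_node by (metis prod.inject)
      ultimately have "node (y w) = node (y w')" using close_imp_conn by (simp add: node_eq_iff)
      then show "w = w'" using y w by simp
    qed
    moreover have "(\<lambda>w. (node_level w, f w)) ` W \<subseteq> I"
      using f(1) adj_node_level[of "node x"] by (force simp: I_def W_def node_level_node)
    ultimately have "finite W \<and> card W \<le> 2 * N"
      using I inj_on_finite card_inj_on_le le_trans by metis
    then show ?thesis by (simp add: W_def)
  qed
  then show ?thesis unfolding degree_def by blast
qed

lemma bounded_valence_bushy_tree_node: "bounded_valence_bushy_tree (range node) adj"
proof -
  have "degree (range node) adj v \<noteq> 1" if v: "v \<in> range node" for v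
  proof
    assume "degree (range node) adj v = 1"
    then obtain w where w: "{w \<in> range node. adj v w} = {w}"
      unfolding degree_def by (rule card_1_singletonE)
    obtain x where "v = node x" using v by blast
    then obtain a b where ab: "a \<noteq> b" "adj v a" "adj v b" using two_neighbours[of x] by blast
    then have "a \<in> {w \<in> range node. adj v w}" "b \<in> {w \<in> range node. adj v w}"
      using adj_range by auto
    then show False using w ab(1) by simp
  qed
  then show ?thesis
    unfolding bounded_valence_bushy_tree_def using simplicial_tree_node bounded_degree by blast
qed

end

theorem theorem5p9:
  fixes x0 :: "'a::metric_space"
  assumes "proper_space TYPE('a)"
    and "cocompact TYPE('a)"
    and "geodesically_complete TYPE('a)"
    and "CAT0 TYPE('a)"
    and "cone_topology x0 homeomorphic_space (top_of_set cantor_set)"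
  shows "\<exists>(V::nat set) E. bounded_valence_bushy_tree V E \<and>
           quasi_isometric (UNIV::'a set) dist V (\<lambda>u v. real (graph_dist E u v))"
proof -
  \<comment> \<open>The Cantor set contains 0, so the boundary homeomorphic to it has a
    point.\<close>
  have ne: "rays_from x0 \<noteq> {}"
    using homeomorphic_empty_space[OF assms(5)] zero_in_cantor_set
      null_topspace_iff_trivial[of "cone_topology x0"]
      null_topspace_iff_trivial[of "top_of_set cantor_set"]
    by (auto simp: topspace_cone_topology)
  obtain T e where Te: "T > 0" "e > 0"
    "\<And>A q x y::'a. chain_connected A e x y \<Longrightarrow> x \<in> A \<Longrightarrow> dist x q + dist q y = dist x y \<Longrightarrow>
      \<exists>z\<in>A. dist q z < T"
    using cantor_boundary_bottleneck[OF assms(2-5) ne] by blast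
  interpret bottleneck_space x0 T e
  proof
    show "\<exists>c\<in>rays_from x0. c (dist x0 x) = x" for x
      using ray_through_point[OF assms(3,4) ne] by blast
    \<comment> \<open>The unit piece of a ray is a nondegenerate segment, which geodesic
      completeness extends to a line through \<open>x0\<close>.\<close>
    obtain c where c: "c \<in> rays_from x0" using ne by blast
    have d: "dist x0 (c 1) = 1" using rays_from_dist_base[OF c, of 1] by simp
    then have "geodesic_segment c x0 (c 1)"
      using rays_from_dist[OF c] rays_from_zero[OF c] by (auto simp: geodesic_segment_def)
    moreover have "x0 \<noteq> c 1" using d by auto
    ultimately obtain l where "geodesic_line l" "\<forall>s\<in>{0..dist x0 (c 1)}. l s = c s"
      using assms(3) unfolding geodesically_complete_def by blast
    then show "\<exists>l. geodesic_line l \<and> l 0 = x0" using rays_from_zero[OF c] by auto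
  qed (use Te CAT0_imp_geodesic[OF assms(4)] cocompact_proper_uniformly_covered[OF assms(1,2)] in auto)
  show ?thesis
    using bounded_valence_bushy_tree_node quasi_isometry_node unfolding quasi_isometric_def by blast
qed

end
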